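(* Let $n\ge 1$ and $l\ge 0$ be integers and $L=\{0,1,\dots,l\}$. For each $i\in L$ let $A_i\in\mathbb{R}^{n\times n}$, $B_i\in\mathbb{R}^{n\times 1}$, $K_i\in\mathbb{R}^{1\times n}$. Let $D>0$ and let $\sigma:[0,\infty)\to L$ be a right-continuous, piecewise constant switching signal with dwell time $\tau_d>0$ (any two distinct switching instants of $\sigma$ are at least $\tau_d$ apart). Consider the closed-loop system $$\dot X(t)=A_{\sigma(t)}X(t)+B_{\sigma(t)}U(t-D),\quad t\ge 0,$$ $$U(t)=\frac{1}{l+1}\sum_{i=0}^{l}K_i\hat P_i(t),\qquad \hat P_i(t)=e^{A_iD}X(t)+\int_{t-D}^{t}e^{A_i(t-\theta)}B_iU(\theta)\,d\theta,\quad t\ge 0,$$ with initial data $X(0)=X_0\in\mathbb{R}^n$ and $U(\theta)=U_0(\theta)$ for $\theta\in[-D,0)$, $U_0\in L^2[-D,0]$. Assume that each pair $(A_i,B_i)$ is controllable, that each $A_i+B_iK_i$ is Hurwitz, and that there exist common symmetric matrices $P>0$, $Q>0$ with $$(A_i+B_iK_i)^TP+P(A_i+B_iK_i)\le -Q,\qquad i=0,\dots,l.$$ Let $\epsilon=\max_{i,j\in L}\max\{|A_i-A_j|,|B_i-B_j|,|K_i-K_j|\}$. Then there exists $\epsilon^*>0$ such that if $\epsilon<\epsilon^*$, then for all $X_0\in\mathbb{R}^n$, $U_0\in L^2[-D,0]$ there exist positive constants $\rho,\xi$ such that $$|X(t)|+\sqrt{\int_{t-D}^{t}U(\theta)^2d\theta}\le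 \rho\left(|X(0)|+\sqrt{\int_{-D}^{0}U(\theta)^2d\theta}\right)e^{-\xi t},\quad t\ge 0.$$
   Context: $|\cdot|$ denotes the Euclidean norm on vectors and the induced matrix norm on matrices. The state has no jumps at switching times; $(X,U)$ denotes the solution of the closed-loop system. The future values $\sigma(t+s)$, $s>0$, are not used by the controller. *)

theory Defs
  imports "HOL-Analysis.Analysis"
begin

text \<open>Matrices are elements of real^'n^'n; column vectors B and row vectors K
 (both n-dimensional) are elements of real^'n.  The row vector K acts on x by K \<bullet> x.\<close>

primrec matpow :: "real^'n^'n \<Rightarrow> nat \<Rightarrow> real^'n^'n" where
  "matpow M 0 = mat 1"
| "matpow M (Suc k) = M ** matpow M k"

definition mexp :: "real^'n^'n \<Rightarrow> real^'n^'n" where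
  "mexp M = (\<Sum>k. (1 / fact k) *\<^sub>R matpow M k)"

definition outer :: "real^'n \<Rightarrow> real^'n \<Rightarrow> real^'n^'n" where
  "outer b k = (\<chi> r c. b $ r * k $ c)"

text \<open>Controllability of (A,B): Kalman rank condition
  rank [B, AB, ..., A^(n-1) B] = n.\<close>
definition controllable :: "real^'n^'n \<Rightarrow> real^'n \<Rightarrow> bool" where
  "controllable A b \<longleftrightarrow> span {matpow A k *v b | k. k < CARD('n)} = UNIV"

definition hurwitz :: "real^'n^'n \<Rightarrow> bool" where
  "hurwitz M \<longleftrightarrow> (\<forall>(lam::complex) (v::complex^'n). v \<noteq> 0 \<and>
      (\<chi> i j. complex_of_real (M $ i $ j)) *v v = (\<chi> i. lam * v $ i) \<longrightarrow> Re lam < 0)"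

definition sym_pos_def :: "real^'n^'n \<Rightarrow> bool" where
  "sym_pos_def P \<longleftrightarrow> transpose P = P \<and> (\<forall>x. x \<noteq> 0 \<longrightarrow> x \<bullet> (P *v x) > 0)"

definition loewner_le :: "real^'n^'n \<Rightarrow> real^'n^'n \<Rightarrow> bool" where
  "loewner_le M N \<longleftrightarrow> (\<forall>x. x \<bullet> (M *v x) \<le> x \<bullet> (N *v x))"

definition switching_instants :: "(real \<Rightarrow> nat) \<Rightarrow> real set" where
  "switching_instants sig = {t. t > 0 \<and> \<not> (\<exists>d>0. \<forall>s\<in>{t-d<..t}. sig s = sig t)}"

definition dwell_signal :: "(real \<Rightarrow> nat) \<Rightarrow> nat \<Rightarrow> real \<Rightarrow> bool" where
  "dwell_signal sig l tau \<longleftrightarrow> tau > 0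
     \<and> (\<forall>t\<ge>0. sig t \<le> l)
     \<and> (\<forall>t\<ge>0. \<exists>d>0. \<forall>s\<in>{t..<t+d}. sig s = sig t)
     \<and> (\<forall>t1\<in>switching_instants sig. \<forall>t2\<in>switching_instants sig.
           t1 \<noteq> t2 \<longrightarrow> \<bar>t1 - t2\<bar> \<ge> tau)"

text \<open>epsilon = max over i,j in L of max(|A_i-A_j|, |B_i-B_j|, |K_i-K_j|), induced norms
 (for n x 1 and 1 x n matrices the induced norm is the Euclidean norm).\<close>
definition mismatch :: "nat \<Rightarrow> (nat \<Rightarrow> real^'n^'n) \<Rightarrow> (nat \<Rightarrow> real^'n) \<Rightarrow> (nat \<Rightarrow> real^'n) \<Rightarrow> real" where
  "mismatch l A B K = Max {max (onorm (\<lambda>x. (A i - A j) *v x)) (max (norm (B i - B j)) (norm (K i - K j)))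
                          | i j. i \<le> l \<and> j \<le> l}"

definition pred :: "real \<Rightarrow> real^'n^'n \<Rightarrow> real^'n \<Rightarrow> (real \<Rightarrow> real^'n) \<Rightarrow> (real \<Rightarrow> real) \<Rightarrow> real \<Rightarrow> real^'n" where
  "pred D Ai Bi X U t = mexp (D *\<^sub>R Ai) *v X t
      + integral {t - D..t} (\<lambda>\<theta>. U \<theta> *\<^sub>R (mexp ((t - \<theta>) *\<^sub>R Ai) *v Bi))"

text \<open>(X,U) is a solution of the closed-loop system with initial data X0, U0.
 The ODE is imposed in integral (Caratheodory) form, so X has no jumps.\<close>
definition closed_loop_solution ::
  "nat \<Rightarrow> (nat \<Rightarrow> real^'n^'n) \<Rightarrow> (nat \<Rightarrow> real^'n) \<Rightarrow> (nat \<Rightarrow> real^'n) \<Rightarrow> real \<Rightarrow> (real \<Rightarrow> nat)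
   \<Rightarrow> real^'n \<Rightarrow> (real \<Rightarrow> real) \<Rightarrow> (real \<Rightarrow> real^'n) \<Rightarrow> (real \<Rightarrow> real) \<Rightarrow> bool" where
  "closed_loop_solution l A B K D sig X0 U0 X U \<longleftrightarrow>
     (\<forall>\<theta>. -D \<le> \<theta> \<and> \<theta> < 0 \<longrightarrow> U \<theta> = U0 \<theta>)
   \<and> (\<forall>t\<ge>0. U measurable_on {-D..t} \<and> (\<lambda>\<theta>. (U \<theta>)\<^sup>2) integrable_on {-D..t})
   \<and> (\<forall>t\<ge>0. ((\<lambda>s. A (sig s) *v X s + U (s - D) *\<^sub>R B (sig s)) has_integral (X t - X0)) {0..t})
   \<and> (\<forall>t\<ge>0. U t = (1 / real (l + 1)) * (\<Sum>i\<le>l. K i \<bullet> pred D (A i) (B i) X U t))"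

end

theory Submission
  imports Defs
begin

text \<open>
  The predictor of mode \<open>i\<close> is exact for the plant frozen in mode \<open>i\<close>, so \<open>X (t + D)\<close> differs from
  every \<open>pred D (A i) (B i) X U t\<close> by a term proportional to the mismatch \<open>\<epsilon>\<close>. Hence
  \<open>U t = K 0 \<bullet> X (t + D) + O(\<epsilon>)\<close>, and from time \<open>D\<close> on the state solves the delay-free equation of
  \<open>A 0 + B 0 K 0\<close>, exponentially stable by the Lyapunov inequality, up to an \<open>O(\<epsilon>)\<close> perturbation.
  Let \<open>N\<close> be the supremum of \<open>exp (\<xi> t) |X t|\<close> and \<open>exp (\<xi> t) |U t|\<close> over a finite horizon. Variation
  of constants yields \<open>N \<le> C (|X 0| + |U|) + \<epsilon> C N\<close> with \<open>C\<close> independent of the horizon, where \<open>|U|\<close>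
  is the norm of the initial input, and for small \<open>\<epsilon>\<close> the last term is absorbed.
\<close>

section \<open>Integrals on the real line\<close>

text \<open>Four obstacles shape the argument. On [-D, 0) the input is merely square integrable and
  has no pointwise bound, so it enters through its integral only; on [0, D] the state is driven by
  this input rather than by the feedback, and gets a separate growth estimate. The differential
  equation holds only in integral form with a discontinuous right-hand side, so variation of
  constants rests on a product rule for primitives of integrable functions. Absorbing a multiple of
  \<open>N\<close> presupposes that \<open>N\<close> is finite: continuity bounds the state on a
  compact interval, and the feedback law then bounds the input. Finally the estimate must close on
  one horizon although \<open>U t\<close> is compared with \<open>X (t + D)\<close>: the input is
  followed up to \<open>T\<close> and the state up to \<open>T + D\<close>, and the bounds on these
  two intervals reproduce themselves. The rate \<xi> is half the decay rate given by the Lyapunov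
  inequality; the other half makes the convolution in the variation of constants converge. All
  constants come from mode 0, with 1 added to its norms to cover every mode at mismatch at most
  1.\<close>

lemma has_integral_norm_bound:
  fixes f :: "'a::euclidean_space \<Rightarrow> 'b::banach"
  assumes "(f has_integral I) S" and "g integrable_on S" and "\<And>s. s \<in> S \<Longrightarrow> norm (f s) \<le> g s"
  shows "norm I \<le> integral S g"
proof -
  have "norm (integral S f) \<le> integral S g"
    using has_integral_integrable[OF assms(1)] assms(2,3) by (rule integral_norm_bound_integral)
  then show ?thesis unfolding integral_unique[OF assms(1)] .
qed

lemma continuous_on_indefinite_integral:
  fixes x :: "real \<Rightarrow> 'a::banach"
  assumes "\<And>t. t \<in> {a..b} \<Longrightarrow> (f has_integral x t - x a) {a..t}"
  shows "continuous_on {a..b} x"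
proof (cases "a \<le> b")
  case True
  then have "f integrable_on {a..b}" using assms[of b] by (auto simp: has_integral_iff)
  then have "continuous_on {a..b} (\<lambda>t. x a + integral {a..t} f)"
    by (intro continuous_intros indefinite_integral_continuous_1)
  moreover have "x a + integral {a..t} f = x t" if "t \<in> {a..b}" for t
    using assms[OF that] by (auto simp: has_integral_iff)
  ultimately show ?thesis using continuous_on_eq by blast
qed auto

lemma has_integral_product_rule:
  fixes h :: "'a::euclidean_space \<Rightarrow> 'b::euclidean_space \<Rightarrow> 'c::euclidean_space"
    and F :: "real \<Rightarrow> 'a"
  assumes "bilinear h" and "a \<le> b"
    and F: "\<And>t. t \<in> {a..b} \<Longrightarrow> (F has_vector_derivative F' t) (at t within {a..b})"
    and F': "continuous_on {a..b} F'"
    and g: "g absolutely_integrable_on {a..b}"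
    and G: "\<And>t. t \<in> {a..b} \<Longrightarrow> (g has_integral G t - G a) {a..t}"
  shows "((\<lambda>s. h (F' s) (G s) + h (F s) (g s)) has_integral h (F b) (G b) - h (F a) (G a)) {a..b}"
proof -
  obtain B where "B > 0" and B: "\<And>x y. norm (h x y) \<le> B * norm x * norm y"
    using bilinear_bounded_pos \<open>bilinear h\<close> by blast
  have bb: "bounded_bilinear h"
    using \<open>bilinear h\<close> by (simp add: bilinear_conv_bounded_bilinear)
  obtain L where "L > 0" and L: "\<And>t. t \<in> {a..b} \<Longrightarrow> norm (F' t) \<le> L"
    using compact_continuous_image[OF F' compact_Icc] compact_imp_bounded bounded_pos
    by (metis imageI)
  have contF: "continuous_on {a..b} F"
    unfolding continuous_on_eq_continuous_within using F has_vector_derivative_continuous by blast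
  have gi: "g integrable_on {a..b}" and ngi: "(\<lambda>s. norm (g s)) integrable_on {a..b}"
    using g by (auto simp: absolutely_integrable_on_def)
  \<comment> \<open>\<open>H\<close> dominates the increments of \<open>G\<close> and is continuous;
    this continuity turns the product bound on the increments of \<open>R\<close> into little-o of
    \<open>t - s\<close>.\<close>
  define H where "H t = integral {a..t} (\<lambda>s. norm (g s))" for t
  have contH: "continuous_on {a..b} H"
    unfolding H_def using indefinite_integral_continuous_1 ngi by blast
  have Gst: "(g has_integral G t - G s) {s..t}" if "a \<le> s" "s \<le> t" "t \<le> b" for s t
  proof -
    have "g integrable_on {s..t}" using gi that by (simp add: integrable_on_subinterval)
    moreover have "integral {a..s} g + integral {s..t} g = integral {a..t} g"
      using that gi by (intro Henstock_Kurzweil_Integration.integral_combine) (auto intro: integrable_on_subinterval)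
    moreover have "integral {a..s} g = G s - G a" "integral {a..t} g = G t - G a"
      using G that by (auto intro!: integral_unique)
    ultimately show ?thesis by (simp add: has_integral_iff algebra_simps)
  qed
  have Hst: "((\<lambda>r. norm (g r)) has_integral H t - H s) {s..t}" if "a \<le> s" "s \<le> t" "t \<le> b" for s t
  proof -
    have "(\<lambda>r. norm (g r)) integrable_on {s..t}" using ngi that by (simp add: integrable_on_subinterval)
    moreover have "H s + integral {s..t} (\<lambda>r. norm (g r)) = H t"
      unfolding H_def using that ngi
      by (intro Henstock_Kurzweil_Integration.integral_combine) (auto intro: integrable_on_subinterval)
    ultimately show ?thesis by (simp add: has_integral_iff algebra_simps)
  qed
  have Fst: "(F' has_integral F t - F s) {s..t}" if st: "a \<le> s" "s \<le> t" "t \<le> b" for s t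
  proof (rule fundamental_theorem_of_calculus)
    show "(F has_vector_derivative F' x) (at x within {s..t})" if "x \<in> {s..t}" for x
      using F[of x] that st by (auto intro: has_vector_derivative_within_subset)
  qed (fact st)
  have GH: "norm (G t - G s) \<le> H t - H s" if "a \<le> s" "s \<le> t" "t \<le> b" for s t
    using integral_norm_bound_integral[of g "{s..t}" "\<lambda>r. norm (g r)"] Gst[OF that] Hst[OF that]
    by (auto simp: has_integral_iff)
  have Hmono: "H s \<le> H t" if "a \<le> s" "s \<le> t" "t \<le> b" for s t
    using GH[OF that] norm_ge_zero[of "G t - G s"] by linarith
  have FL: "norm (F t - F s) \<le> L * (t - s)" if "a \<le> s" "s \<le> t" "t \<le> b" for s t
    using has_integral_bound_real[of L "{}" F' "F t - F s" s t] Fst[OF that] L that \<open>L > 0\<close>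
    by (auto simp: less_imp_le)
  have contG: "continuous_on {a..b} G"
    using G by (rule continuous_on_indefinite_integral)
  define phi where "phi s = h (F' s) (G s) + h (F s) (g s)" for s
  have "(\<lambda>s. h (F s) (g s)) absolutely_integrable_on {a..b}"
  proof (rule absolutely_integrable_bounded_measurable_product[OF \<open>bilinear h\<close> _ _ _ g])
    show "F \<in> borel_measurable (lebesgue_on {a..b})"
      using contF by (rule continuous_imp_measurable_on_sets_lebesgue) simp
    show "bounded (F ` {a..b})"
      using contF by (intro compact_imp_bounded compact_continuous_image) auto
  qed simp
  then have "(\<lambda>s. h (F s) (g s)) integrable_on {a..b}"
    by (simp add: absolutely_integrable_on_def)
  moreover have "(\<lambda>s. h (F' s) (G s)) integrable_on {a..b}"
    by (intro integrable_continuous_real bounded_bilinear.continuous_on[OF bb] F' contG)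
  ultimately have phi: "phi integrable_on {a..b}"
    unfolding phi_def by (intro integrable_add)
  \<comment> \<open>Increments of \<open>R\<close> over \<open>{s..t}\<close> are at most \<open>t - s\<close> times a vanishing factor, so \<open>R' = 0\<close>
    everywhere although \<open>g\<close> is merely integrable.\<close>
  define R where "R t = h (F t) (G t) - integral {a..t} phi" for t
  have key: "norm (R t - R s) \<le> 2 * B * L * (t - s) * (H t - H s)" if st: "a \<le> s" "s \<le> t" "t \<le> b" for s t
  proof -
    have 1: "(phi has_integral integral {a..t} phi - integral {a..s} phi) {s..t}"
    proof -
      have "phi integrable_on {s..t}" using phi that by (simp add: integrable_on_subinterval)
      moreover have "integral {a..s} phi + integral {s..t} phi = integral {a..t} phi"
        using that phi
        by (intro Henstock_Kurzweil_Integration.integral_combine) (auto intro: integrable_on_subinterval)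
      ultimately show ?thesis by (simp add: has_integral_iff algebra_simps)
    qed
    \<comment> \<open>Freezing \<open>G\<close> at \<open>s\<close> and \<open>F\<close> at
      \<open>t\<close> telescopes: the value is exactly
      \<open>h (F t) (G t) - h (F s) (G s)\<close>. Subtracting \<open>phi\<close> then leaves terms
      that each contain an increment of \<open>F\<close> or of \<open>G\<close>.\<close>
    have 2: "((\<lambda>r. h (F' r) (G s) + h (F t) (g r)) has_integral h (F t - F s) (G s) + h (F t) (G t - G s)) {s..t}"
      using has_integral_linear[OF Fst[OF st] bounded_bilinear.bounded_linear_left[OF bb, of "G s"]]
        has_integral_linear[OF Gst[OF st] bounded_bilinear.bounded_linear_right[OF bb, of "F t"]]
      by (intro has_integral_add) (auto simp: o_def)
    have "((\<lambda>r. h (F' r) (G s - G r) + h (F t - F r) (g r)) has_integral R t - R s) {s..t}"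
      using has_integral_diff[OF 2 1]
      by (simp add: R_def phi_def bounded_bilinear.diff_left[OF bb] bounded_bilinear.diff_right[OF bb]
          algebra_simps)
    moreover have "((\<lambda>r. B * L * (H t - H s) + B * L * (t - s) * norm (g r)) has_integral
        B * L * (H t - H s) * (t - s) + B * L * (t - s) * (H t - H s)) {s..t}"
      using has_integral_const_real[of "B * L * (H t - H s)" s t] Hst[OF st] st
      by (intro has_integral_add has_integral_mult_right) (auto simp: mult.commute)
    moreover have "norm (h (F' r) (G s - G r) + h (F t - F r) (g r))
        \<le> B * L * (H t - H s) + B * L * (t - s) * norm (g r)" if "r \<in> {s..t}" for r
    proof -
      have "norm (G s - G r) \<le> H t - H s"
        using GH[of s r] Hmono[of r t] that st by (auto simp: norm_minus_commute)
      then have "norm (F' r) * norm (G s - G r) \<le> L * (H t - H s)"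
        using L[of r] that st \<open>L > 0\<close> by (intro mult_mono) auto
      then have "B * (norm (F' r) * norm (G s - G r)) \<le> B * (L * (H t - H s))"
        using \<open>B > 0\<close> by (intro mult_left_mono) auto
      moreover have "norm (F t - F r) \<le> L * (t - s)"
      proof -
        have "norm (F t - F r) \<le> L * (t - r)" using FL that st by auto
        also have "\<dots> \<le> L * (t - s)" using that \<open>L > 0\<close> by auto
        finally show ?thesis .
      qed
      then have "B * (norm (F t - F r) * norm (g r)) \<le> B * (L * (t - s) * norm (g r))"
        using \<open>B > 0\<close> by (intro mult_left_mono mult_right_mono) auto
      moreover have "norm (h (F' r) (G s - G r) + h (F t - F r) (g r))
          \<le> B * norm (F' r) * norm (G s - G r) + B * norm (F t - F r) * norm (g r)"
        by (intro norm_triangle_mono B)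
      ultimately show ?thesis by (simp add: mult.assoc)
    qed
    ultimately have "norm (R t - R s) \<le> B * L * (H t - H s) * (t - s) + B * L * (t - s) * (H t - H s)"
      using integral_norm_bound_integral by (metis (no_types, lifting) has_integral_iff)
    then show ?thesis by (simp add: algebra_simps)
  qed
  have key': "norm (R t - R s) \<le> 2 * B * L * \<bar>t - s\<bar> * \<bar>H t - H s\<bar>" if "s \<in> {a..b}" "t \<in> {a..b}" for s t
  proof (cases "s \<le> t")
    case True
    then show ?thesis using key[of s t] Hmono[of s t] that by auto
  next
    case False
    then show ?thesis using key[of t s] Hmono[of t s] that
      by (auto simp: norm_minus_commute abs_minus_commute)
  qed
  have "(R has_vector_derivative 0) (at x within {a..b})" if x: "x \<in> {a..b}" for x
    unfolding has_vector_derivative_def has_derivative_within_alt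
  proof (intro conjI allI impI)
    fix e :: real assume "e > 0"
    define e' where "e' = e / (2 * B * L)"
    have "e' > 0" using \<open>e > 0\<close> \<open>B > 0\<close> \<open>L > 0\<close> by (simp add: e'_def)
    then obtain d where "d > 0" and d: "\<And>y. y \<in> {a..b} \<Longrightarrow> dist y x < d \<Longrightarrow> dist (H y) (H x) < e'"
      using contH x unfolding continuous_on_iff by metis
    show "\<exists>d>0. \<forall>y\<in>{a..b}. norm (y - x) < d \<longrightarrow> norm (R y - R x - (y - x) *\<^sub>R 0) \<le> e * norm (y - x)"
    proof (intro exI conjI ballI impI)
      fix y assume y: "y \<in> {a..b}" "norm (y - x) < d"
      have "norm (R y - R x) \<le> 2 * B * L * \<bar>y - x\<bar> * \<bar>H y - H x\<bar>" using key' x y by auto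
      also have "\<dots> \<le> 2 * B * L * \<bar>y - x\<bar> * e'"
        using d[of y] y \<open>B > 0\<close> \<open>L > 0\<close> by (intro mult_left_mono) (auto simp: dist_real_def)
      also have "\<dots> = e * \<bar>y - x\<bar>" using \<open>B > 0\<close> \<open>L > 0\<close> by (simp add: e'_def)
      finally show "norm (R y - R x - (y - x) *\<^sub>R 0) \<le> e * norm (y - x)" by simp
    qed (fact \<open>d > 0\<close>)
  qed (simp add: bounded_linear_zero)
  then obtain c where "\<And>x. x \<in> {a..b} \<Longrightarrow> R x = c"
    using has_vector_derivative_zero_constant[of "{a..b}" R] by auto
  then have "R a = R b" using \<open>a \<le> b\<close> by simp
  then have "integral {a..b} phi = h (F b) (G b) - h (F a) (G a)" by (simp add: R_def algebra_simps)
  then show ?thesis using phi unfolding phi_def by (simp add: has_integral_iff)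
qed

lemma integral_le_const:
  fixes f :: "real \<Rightarrow> real"
  assumes "p \<le> q" "f integrable_on {p..q}" "\<And>s. s \<in> {p..q} \<Longrightarrow> f s \<le> C"
  shows "integral {p..q} f \<le> C * (q - p)"
proof -
  have "integral {p..q} f \<le> integral {p..q} (\<lambda>s. C)"
    by (rule integral_le) (use assms in auto)
  then show ?thesis using assms(1) by (simp add: mult.commute)
qed

text \<open>Cauchy-Schwarz against the constant 1, by integrating the square of the deviation of
  \<open>\<bar>u s\<bar>\<close> from its mean \<open>I / d\<close>. It converts the square-integral
  norm of the initial data into the integral of \<open>\<bar>U s\<bar>\<close> used by the
  estimates.\<close>

lemma integral_abs_le_sqrt:
  fixes u :: "real \<Rightarrow> real"
  assumes "a \<le> b" and u: "(\<lambda>s. \<bar>u s\<bar>) integrable_on {a..b}" and u2: "(\<lambda>s. (u s)\<^sup>2) integrable_on {a..b}"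
  shows "integral {a..b} (\<lambda>s. \<bar>u s\<bar>) \<le> sqrt (b - a) * sqrt (integral {a..b} (\<lambda>s. (u s)\<^sup>2))"
proof (cases "a = b")
  case False
  define d I S where "d = b - a" and "I = integral {a..b} (\<lambda>s. \<bar>u s\<bar>)" and "S = integral {a..b} (\<lambda>s. (u s)\<^sup>2)"
  have "d > 0" using assms(1) False by (simp add: d_def)
  have "((\<lambda>s. (u s)\<^sup>2 - 2 * (I / d) * \<bar>u s\<bar> + (I / d)\<^sup>2) has_integral S - 2 * (I / d) * I + (I / d)\<^sup>2 * d) {a..b}"
    using has_integral_const_real[of "(I / d)\<^sup>2" a b] assms
    by (intro has_integral_add has_integral_diff has_integral_mult_right)
      (auto simp: I_def S_def d_def integrable_integral mult.commute)
  then have "0 \<le> S - 2 * (I / d) * I + (I / d)\<^sup>2 * d"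
  proof (rule has_integral_nonneg)
    show "0 \<le> (u s)\<^sup>2 - 2 * (I / d) * \<bar>u s\<bar> + (I / d)\<^sup>2" for s
      using zero_le_power2[of "\<bar>u s\<bar> - I / d"] by (simp add: power2_diff mult_ac)
  qed
  then have "I\<^sup>2 \<le> d * S" using \<open>d > 0\<close> by (simp add: field_simps power2_eq_square)
  then have "I \<le> sqrt (d * S)" by (rule real_le_rsqrt)
  then show ?thesis by (simp add: d_def I_def S_def real_sqrt_mult)
qed simp

section \<open>The matrix exponential\<close>

lemma matrix_vector_bilinear: "bilinear ((*v) :: real^'n^'m \<Rightarrow> real^'n \<Rightarrow> real^'m)"
  unfolding bilinear_def
  by (auto intro!: linearI simp: matrix_vector_right_distrib matrix_vector_mult_add_rdistrib
      scaleR_matrix_vector_assoc[symmetric] matrix_vector_mult_scaleR)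

lemma norm_matpow_le:
  fixes A :: "real^'n^'n"
  assumes "\<And>x. norm (A *v x) \<le> a * norm x" and "a \<ge> 0"
  shows "norm (matpow A k *v x) \<le> a ^ k * norm x"
proof (induction k)
  case (Suc k)
  have "norm (matpow A (Suc k) *v x) \<le> a * norm (matpow A k *v x)"
    using assms(1) by (simp add: matrix_vector_mul_assoc[symmetric])
  also have "\<dots> \<le> a * (a ^ k * norm x)" using Suc \<open>a \<ge> 0\<close> by (rule mult_left_mono)
  finally show ?case by (simp add: mult.assoc)
qed simp

lemma matpow_scaleR: "matpow (t *\<^sub>R A) k = t ^ k *\<^sub>R matpow A k"
  by (induction k) (auto simp: matrix_scalar_ac scalar_matrix_assoc[symmetric])
 
lemma matpow_commute: "matpow A k ** A = A ** matpow A k"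
  by (induction k) (auto simp: matrix_mul_assoc[symmetric])

text \<open>Comparison with the scalar exponential series of the operator norm. The norm of the
  matrix type is the Euclidean norm of the entries, so the operator bound is transferred through the
  entries, each a coordinate of the image of a basis vector, at the price of the square of the
  dimension.\<close>

lemma mexp_sums:
  fixes A :: "real^'n^'n"
  shows "(\<lambda>k. (1 / fact k) *\<^sub>R matpow A k) sums mexp A"
proof -
  define a where "a = onorm ((*v) A)"
  have a: "norm (A *v x) \<le> a * norm x" for x
    unfolding a_def by (rule onorm) simp
  have a0: "a \<ge> 0" unfolding a_def by (rule onorm_pos_le) simp
  have entry: "\<bar>matpow A k $ i $ j\<bar> \<le> a ^ k" for k i j
  proof -
    have "\<bar>matpow A k $ i $ j\<bar> = \<bar>(matpow A k *v axis j 1) $ i\<bar>"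
      by (simp add: matrix_vector_mult_basis column_def)
    also have "\<dots> \<le> norm (matpow A k *v axis j 1)" by (rule component_le_norm_cart)
    also have "\<dots> \<le> a ^ k" using norm_matpow_le[OF a a0, of k "axis j 1"] by simp
    finally show ?thesis .
  qed
  have "norm (matpow A k) \<le> real CARD('n) * real CARD('n) * a ^ k" for k
  proof -
    have "norm (matpow A k $ i) \<le> real CARD('n) * a ^ k" for i
      using norm_le_l1_cart[of "matpow A k $ i"] sum_bounded_above[of UNIV "\<lambda>j. \<bar>matpow A k $ i $ j\<bar>" "a ^ k"] entry
      by (auto intro: order_trans)
    moreover have "norm (matpow A k) \<le> (\<Sum>i\<in>UNIV. norm (matpow A k $ i))"
      unfolding norm_vec_def by (rule L2_set_le_sum) auto
    ultimately show ?thesis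
      using sum_bounded_above[of UNIV "\<lambda>i. norm (matpow A k $ i)" "real CARD('n) * a ^ k"]
      by (simp add: mult.assoc)
  qed
  then have bd: "norm ((1 / fact k) *\<^sub>R matpow A k) \<le> real CARD('n) * real CARD('n) * (inverse (fact k) * a ^ k)" for k
    by (simp add: field_simps)
  have "summable (\<lambda>k. real CARD('n) * real CARD('n) * (inverse (fact k) * a ^ k))"
    by (intro summable_mult summable_exp)
  then have "summable (\<lambda>k. (1 / fact k) *\<^sub>R matpow A k)"
    by (rule summable_comparison_test'[where N = 0]) (rule bd)
  then show ?thesis unfolding mexp_def by (rule summable_sums)
qed

lemma bounded_linear_matrix_vector_left: "bounded_linear (\<lambda>N :: real^'n^'m. N *v x)"
  using matrix_vector_bilinear bilinear_conv_bounded_bilinear bounded_bilinear.bounded_linear_left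
  by blast

lemma mexp_0: "mexp (0 :: real^'n^'n) = mat 1"
proof -
  have "(\<lambda>k. (1 / fact k) *\<^sub>R matpow (0 :: real^'n^'n) k) sums (\<Sum>k\<in>{0}. (1 / fact k) *\<^sub>R matpow (0 :: real^'n^'n) k)"
    by (rule sums_finite) (auto simp: gr0_conv_Suc)
  then show ?thesis using mexp_sums[of "0 :: real^'n^'n"] sums_unique2 by force
qed

text \<open>The series is applied to \<open>x\<close> before norms are taken, so that the operator
  bound \<open>a\<close> enters directly and no dimension factor appears.\<close>

lemma norm_mexp_le:
  fixes A :: "real^'n^'n"
  assumes "\<And>x. norm (A *v x) \<le> a * norm x" and "a \<ge> 0" and "t \<ge> 0"
  shows "norm (mexp (t *\<^sub>R A) *v x) \<le> exp (a * t) * norm x"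
proof -
  have s: "(\<lambda>k. ((1 / fact k) *\<^sub>R matpow (t *\<^sub>R A) k) *v x) sums (mexp (t *\<^sub>R A) *v x)"
    by (rule bounded_linear.sums[OF bounded_linear_matrix_vector_left mexp_sums])
  have e: "(\<lambda>k. (a * t) ^ k /\<^sub>R fact k * norm x) sums (exp (a * t) * norm x)"
    by (intro sums_mult2 exp_converges)
  have "norm (((1 / fact k) *\<^sub>R matpow (t *\<^sub>R A) k) *v x) \<le> (a * t) ^ k /\<^sub>R fact k * norm x" for k
  proof -
    have "norm (((1 / fact k) *\<^sub>R matpow (t *\<^sub>R A) k) *v x) = t ^ k / fact k * norm (matpow A k *v x)"
      using \<open>t \<ge> 0\<close> by (simp add: matpow_scaleR scaleR_matrix_vector_assoc[symmetric])
    also have "\<dots> \<le> t ^ k / fact k * (a ^ k * norm x)"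
      using \<open>t \<ge> 0\<close> norm_matpow_le[OF assms(1,2)] by (intro mult_left_mono) auto
    finally show ?thesis by (simp add: power_mult_distrib field_simps)
  qed
  then have "norm (\<Sum>k. ((1 / fact k) *\<^sub>R matpow (t *\<^sub>R A) k) *v x) \<le> (\<Sum>k. (a * t) ^ k /\<^sub>R fact k * norm x)"
    using e by (intro norm_suminf_le) (auto simp: sums_iff)
  then show ?thesis using s e by (simp add: sums_iff)
qed

lemma bounded_linear_matrix_mult:
  fixes A :: "real^'n^'n"
  shows "bounded_linear (\<lambda>N :: real^'n^'n. N ** A)" and "bounded_linear (\<lambda>N :: real^'n^'n. A ** N)"
proof -
  have "linear (\<lambda>N :: real^'n^'n. N ** A)" "linear (\<lambda>N :: real^'n^'n. A ** N)"
    by (auto intro!: linearI simp: matrix_matrix_mult_def vec_eq_iff sum.distrib sum_distrib_left algebra_simps)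
  then show "bounded_linear (\<lambda>N :: real^'n^'n. N ** A)" and "bounded_linear (\<lambda>N :: real^'n^'n. A ** N)"
    by (auto simp: linear_conv_bounded_linear)
qed

lemma matrix_vector_mult_minus_left: "(- A) *v x = - (A *v (x :: real^'n))" for A :: "real^'n^'m"
  by (simp add: matrix_vector_mult_def vec_eq_iff sum_negf)

lemma mexp_commute: "mexp (t *\<^sub>R A) ** A = A ** mexp (t *\<^sub>R A)"
proof -
  show ?thesis
    using bounded_linear.sums[OF bounded_linear_matrix_mult(1)[of A] mexp_sums[of "t *\<^sub>R A"]] bounded_linear.sums[OF bounded_linear_matrix_mult(2)[of A] mexp_sums[of "t *\<^sub>R A"]]
    by (simp add: matpow_scaleR matpow_commute matrix_scalar_ac scalar_matrix_assoc[symmetric] sums_iff)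
qed

text \<open>Each entry is a scalar power series in \<open>t\<close> converging everywhere, hence
  differentiable term by term; \<open>diffs\<close> cancels one factor of the factorial and leaves
  the entries of \<open>A ** matpow A k\<close>.\<close>

lemma mexp_has_vector_derivative:
  fixes A :: "real^'n^'n"
  shows "((\<lambda>t. mexp (t *\<^sub>R A)) has_vector_derivative A ** mexp (t *\<^sub>R A)) (at t within S)"
proof -
  have "((\<lambda>t. mexp (t *\<^sub>R A) $ i $ j) has_field_derivative (A ** mexp (t *\<^sub>R A)) $ i $ j) (at t)" for i j
  proof -
    define c where "c k = matpow A k $ i $ j / fact k" for k
    have bl: "bounded_linear (\<lambda>N :: real^'n^'n. N $ i $ j)" for i j
      by (intro bounded_linear_compose[OF bounded_linear_vec_nth bounded_linear_vec_nth])
    have s: "(\<lambda>k. c k * t ^ k) sums (mexp (t *\<^sub>R A) $ i $ j)" for t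
      using bounded_linear.sums[OF bl mexp_sums[of "t *\<^sub>R A"], of i j]
      by (simp add: c_def matpow_scaleR field_simps)
    have "(\<lambda>k. \<Sum>m\<in>UNIV. A $ i $ m * ((1 / fact k) *\<^sub>R matpow (t *\<^sub>R A) k) $ m $ j) sums
        (\<Sum>m\<in>UNIV. A $ i $ m * mexp (t *\<^sub>R A) $ m $ j)"
      by (intro sums_sum sums_mult bounded_linear.sums[OF bl mexp_sums])
    moreover have "(\<Sum>m\<in>UNIV. A $ i $ m * ((1 / fact k) *\<^sub>R matpow (t *\<^sub>R A) k) $ m $ j) = diffs c k * t ^ k" for k
      by (simp add: diffs_def c_def matpow_scaleR matrix_matrix_mult_def sum_distrib_left sum_distrib_right sum_divide_distrib
          field_simps del: of_nat_Suc)
    ultimately have "(\<Sum>k. diffs c k * t ^ k) = (A ** mexp (t *\<^sub>R A)) $ i $ j"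
      by (simp add: sums_iff matrix_matrix_mult_def)
    then show ?thesis
      using termdiffs_strong_converges_everywhere[of c t] s by (simp add: sums_iff)
  qed
  then have "((\<lambda>t. mexp (t *\<^sub>R A)) has_vector_derivative A ** mexp (t *\<^sub>R A)) (at t)"
    unfolding has_vector_derivative_def has_real_derivative_iff_has_vector_derivative
    by (subst has_derivative_componentwise_within) (auto simp: Basis_vec_def inner_axis)
  then show ?thesis by (rule has_vector_derivative_at_within)
qed

lemma mexp_continuous: "continuous_on S (\<lambda>t. mexp (t *\<^sub>R A))"
  unfolding continuous_on_eq_continuous_within
  by (intro ballI has_vector_derivative_continuous[OF mexp_has_vector_derivative])

text \<open>The product rule is applied to \<open>mexp ((b - s) *\<^sub>R A)\<close> and
  \<open>x s\<close>. The two terms containing \<open>A\<close> cancel because \<open>A\<close>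
  commutes with its exponential, so only the perturbation \<open>g\<close> survives.\<close>

lemma variation_of_constants:
  fixes A :: "real^'n^'n"
  assumes "a \<le> b" and g: "g absolutely_integrable_on {a..b}"
    and x: "\<And>t. t \<in> {a..b} \<Longrightarrow> ((\<lambda>s. A *v x s + g s) has_integral x t - x a) {a..t}"
  shows "((\<lambda>s. mexp ((b - s) *\<^sub>R A) *v g s) has_integral x b - mexp ((b - a) *\<^sub>R A) *v x a) {a..b}"
proof -
  have contx: "continuous_on {a..b} x"
    using x by (rule continuous_on_indefinite_integral)
  have deriv: "((\<lambda>s. mexp ((b - s) *\<^sub>R A)) has_vector_derivative - (A ** mexp ((b - s) *\<^sub>R A))) (at s within S)" for s S
  proof -
    have "((\<lambda>s. b - s) has_vector_derivative - 1) (at s within S)"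
      by (auto intro!: derivative_eq_intros)
    from vector_diff_chain_within[OF this mexp_has_vector_derivative[of A]]
    show ?thesis by (simp add: o_def)
  qed
  have "continuous_on {a..b} (\<lambda>s. mexp ((b - s) *\<^sub>R A))"
    by (rule continuous_on_compose2[OF mexp_continuous[of UNIV]]) (auto intro!: continuous_intros)
  then have contF': "continuous_on {a..b} (\<lambda>s. - (A ** mexp ((b - s) *\<^sub>R A)))"
    by (intro continuous_on_minus bounded_linear.continuous_on[OF bounded_linear_matrix_mult(2)])
  have "(\<lambda>s. A *v x s) absolutely_integrable_on {a..b}"
    by (intro absolutely_integrable_continuous_real bounded_linear.continuous_on[OF _ contx]) simp
  then have ag: "(\<lambda>s. A *v x s + g s) absolutely_integrable_on {a..b}"
    using g by (rule set_integral_add)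
  have "- (A ** mexp ((b - s) *\<^sub>R A)) *v x s + mexp ((b - s) *\<^sub>R A) *v (A *v x s + g s)
      = mexp ((b - s) *\<^sub>R A) *v g s" for s
    by (simp add: matrix_vector_right_distrib matrix_vector_mul_assoc mexp_commute
        matrix_vector_mult_minus_left)
  then show ?thesis
    using has_integral_product_rule[OF matrix_vector_bilinear \<open>a \<le> b\<close> deriv contF' ag x]
    by (simp add: mexp_0)
qed

section \<open>Lyapunov stability\<close>

text \<open>\<open>m\<close> is the minimum of the quadratic form on the unit sphere, attained by
  compactness; homogeneity of degree two extends the bound to all vectors.\<close>

lemma sym_pos_def_lower_bound:
  fixes P :: "real^'n^'n"
  assumes "sym_pos_def P"
  obtains m where "m > 0" and "\<And>x. m * (norm x)\<^sup>2 \<le> x \<bullet> (P *v x)"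
proof -
  have "continuous_on (sphere 0 1) (\<lambda>x. x \<bullet> (P *v x))"
    by (intro continuous_intros bounded_linear.continuous_on) auto
  moreover have "sphere (0 :: real^'n) 1 \<noteq> {}" by simp
  ultimately obtain u :: "real^'n" where u: "norm u = 1" "\<And>y. norm y = 1 \<Longrightarrow> u \<bullet> (P *v u) \<le> y \<bullet> (P *v y)"
    using continuous_attains_inf[OF compact_sphere, of 0 1 "\<lambda>x. x \<bullet> (P *v x)"] by auto
  have "u \<bullet> (P *v u) > 0" 
  proof -
    have "u \<noteq> 0" using u(1) by auto
    then show ?thesis using assms by (simp add: sym_pos_def_def)
  qed
  moreover have "u \<bullet> (P *v u) * (norm x)\<^sup>2 \<le> x \<bullet> (P *v x)" for x
  proof (cases "x = 0")
    case False
    define y where "y = (1 / norm x) *\<^sub>R x"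
    have "x = norm x *\<^sub>R y" "norm y = 1" using False by (auto simp: y_def)
    then have "x \<bullet> (P *v x) = (y \<bullet> (P *v y)) * (norm x)\<^sup>2"
      by (metis (no_types, lifting) inner_scaleR_left inner_scaleR_right matrix_vector_mult_scaleR
          mult.commute mult.left_commute power2_eq_square)
    then show ?thesis using u(2)[OF \<open>norm y = 1\<close>] by (simp add: mult_right_mono)
  qed simp
  ultimately show ?thesis using that by blast
qed

text \<open>Along a trajectory of \<open>M\<close>, the form of \<open>P\<close> multiplied by a
  growing exponential is nonincreasing. Comparing the form with the squared norm gives the factor
  \<open>c\<close>, and the square root halves the rate.\<close>

lemma lyapunov_exponential_decay:
  fixes P Q M :: "real^'n^'n"
  assumes P: "sym_pos_def P" and Q: "sym_pos_def Q"
    and le: "loewner_le (transpose M ** P + P ** M) (- Q)"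
  obtains c \<mu> where "c \<ge> 1" and "\<mu> > 0"
    and "\<And>t x. t \<ge> 0 \<Longrightarrow> norm (mexp (t *\<^sub>R M) *v x) \<le> c * exp (- \<mu> * t) * norm x"
proof -
  obtain p where "p > 0" and p: "\<And>x. p * (norm x)\<^sup>2 \<le> x \<bullet> (P *v x)"
    using sym_pos_def_lower_bound[OF P] by blast
  obtain q where "q > 0" and q: "\<And>x. q * (norm x)\<^sup>2 \<le> x \<bullet> (Q *v x)"
    using sym_pos_def_lower_bound[OF Q] by blast
  \<comment> \<open>The summand \<open>p\<close> guarantees \<open>r \<ge> p\<close>, hence
    \<open>c \<ge> 1\<close> for the ratio \<open>c = sqrt (r / p)\<close>.\<close>
  define r where "r = onorm ((*v) P) + p"
  have "onorm ((*v) P) \<ge> 0" by (rule onorm_pos_le) simp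
  then have "r \<ge> p" "r > 0" using \<open>p > 0\<close> by (auto simp: r_def)
  have r: "x \<bullet> (P *v x) \<le> r * (norm x)\<^sup>2" for x
  proof -
    have "x \<bullet> (P *v x) \<le> norm x * norm (P *v x)" by (rule norm_cauchy_schwarz)
    also have "\<dots> \<le> norm x * (onorm ((*v) P) * norm x)"
      by (intro mult_left_mono onorm) auto
    also have "\<dots> = onorm ((*v) P) * (norm x)\<^sup>2" by (simp add: power2_eq_square)
    also have "\<dots> \<le> r * (norm x)\<^sup>2" using \<open>p > 0\<close> by (intro mult_right_mono) (auto simp: r_def)
    finally show ?thesis .
  qed
  have symP: "x \<bullet> (P *v y) = (P *v x) \<bullet> y" for x y
    using P dot_lmul_matrix[of x P y] unfolding sym_pos_def_def
    by (metis transpose_matrix_vector)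
  have diss: "2 * ((M *v x) \<bullet> (P *v x)) \<le> - (x \<bullet> (Q *v x))" for x
  proof -
    have "x \<bullet> (transpose M *v (P *v x)) = (M *v x) \<bullet> (P *v x)"
      by (metis dot_lmul_matrix inner_commute transpose_matrix_vector transpose_transpose)
    moreover have "x \<bullet> (P *v (M *v x)) = (M *v x) \<bullet> (P *v x)"
      using symP[of x "M *v x"] by (simp add: inner_commute)
    moreover have "x \<bullet> ((transpose M ** P + P ** M) *v x) \<le> - (x \<bullet> (Q *v x))"
      using le unfolding loewner_le_def by (simp add: matrix_vector_mult_minus_left)
    ultimately show ?thesis
      by (simp add: matrix_vector_mult_add_rdistrib inner_add_right matrix_vector_mul_assoc[symmetric])
  qed
  \<comment> \<open>The largest rate these bounds allow: \<open>\<nu> * r = q\<close>, so \<nu>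
    times the form of \<open>P\<close> is at most the dissipation given by \<open>Q\<close>.\<close>
  define \<nu> where "\<nu> = q / r"
  have "\<nu> > 0" using \<open>q > 0\<close> \<open>r > 0\<close> by (simp add: \<nu>_def)
  define c where "c = sqrt (r / p)"
  have "c \<ge> 1" using \<open>r \<ge> p\<close> \<open>p > 0\<close> by (simp add: c_def)
  have "norm (mexp (t *\<^sub>R M) *v x) \<le> c * exp (- (\<nu> / 2) * t) * norm x" if "t \<ge> 0" for t x
  proof -
    define z where "z s = mexp (s *\<^sub>R M) *v x" for s
    have z: "(z has_vector_derivative M *v z s) (at s)" for s
      using bounded_linear.has_vector_derivative[OF bounded_linear_matrix_vector_left mexp_has_vector_derivative]
      unfolding z_def by (simp add: matrix_vector_mul_assoc)
    have Pz: "((\<lambda>s. P *v z s) has_vector_derivative P *v (M *v z s)) (at s)" for s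
      by (rule bounded_linear.has_vector_derivative[OF matrix_vector_mul_bounded_linear z])
    define V where "V s = z s \<bullet> (P *v z s)" for s
    have V: "(V has_real_derivative 2 * ((M *v z s) \<bullet> (P *v z s))) (at s)" for s
    proof -
      have "(V has_vector_derivative z s \<bullet> (P *v (M *v z s)) + (M *v z s) \<bullet> (P *v z s)) (at s)"
        unfolding V_def
        using bounded_bilinear.has_vector_derivative[OF bounded_bilinear_inner z Pz] by blast
      then show ?thesis
        using symP[of "z s" "M *v z s"]
        by (simp add: has_real_derivative_iff_has_vector_derivative inner_commute)
    qed
    define W where "W s = exp (\<nu> * s) * V s" for s
    have "\<exists>y. (W has_real_derivative y) (at s) \<and> y \<le> 0" for s
    proof (intro exI conjI)
      show "(W has_real_derivative exp (\<nu> * s) * (\<nu> * V s + 2 * ((M *v z s) \<bullet> (P *v z s)))) (at s)"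
        unfolding W_def by (auto intro!: derivative_eq_intros V simp: algebra_simps)
      have "\<nu> * V s \<le> \<nu> * (r * (norm (z s))\<^sup>2)"
        unfolding V_def using \<open>\<nu> > 0\<close> r by (intro mult_left_mono) auto
      also have "\<dots> = q * (norm (z s))\<^sup>2" using \<open>r > 0\<close> by (simp add: \<nu>_def)
      also have "\<dots> \<le> z s \<bullet> (Q *v z s)" by (rule q)
      finally have "\<nu> * V s + 2 * ((M *v z s) \<bullet> (P *v z s)) \<le> 0" using diss[of "z s"] by linarith
      then show "exp (\<nu> * s) * (\<nu> * V s + 2 * ((M *v z s) \<bullet> (P *v z s))) \<le> 0"
        by (simp add: mult_nonneg_nonpos)
    qed
    then have "W t \<le> W 0" using DERIV_nonpos_imp_nonincreasing[of 0 t W] that by blast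
    then have "V t \<le> exp (- \<nu> * t) * V 0" by (simp add: W_def exp_minus field_simps)
    moreover have "p * (norm (z t))\<^sup>2 \<le> V t" unfolding V_def by (rule p)
    moreover have "V 0 \<le> r * (norm x)\<^sup>2" using r[of x] by (simp add: V_def z_def mexp_0)
    then have "exp (- \<nu> * t) * V 0 \<le> exp (- \<nu> * t) * (r * (norm x)\<^sup>2)" by simp
    ultimately have "p * (norm (z t))\<^sup>2 \<le> exp (- \<nu> * t) * (r * (norm x)\<^sup>2)" by linarith
    moreover have "exp (- \<nu> * t) = (exp (- (\<nu> / 2) * t))\<^sup>2"
      by (simp add: power2_eq_square exp_add[symmetric])
    moreover have "r = p * c\<^sup>2" using \<open>r > 0\<close> \<open>p > 0\<close> by (simp add: c_def)
    ultimately have "p * (norm (z t))\<^sup>2 \<le> p * (c * exp (- (\<nu> / 2) * t) * norm x)\<^sup>2"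
      by (simp add: power_mult_distrib mult_ac)
    then have "(norm (z t))\<^sup>2 \<le> (c * exp (- (\<nu> / 2) * t) * norm x)\<^sup>2"
      using \<open>p > 0\<close> by (rule mult_left_le_imp_le)
    then show ?thesis unfolding z_def
      by (rule power2_le_imp_le) (use \<open>c \<ge> 1\<close> in auto)
  qed
  moreover have "\<nu> / 2 > 0" using \<open>\<nu> > 0\<close> by simp
  ultimately show ?thesis using that \<open>c \<ge> 1\<close> by blast
qed

section \<open>The closed loop\<close>

lemma mismatch_bounds:
  assumes "i \<le> l" "j \<le> l"
  shows "norm ((A i - A j) *v x) \<le> mismatch l A B K * norm x"
    and "norm (B i - B j) \<le> mismatch l A B K"
    and "norm (K i - K j) \<le> mismatch l A B K"
proof -
  let ?f = "\<lambda>i j. max (onorm (\<lambda>x. (A i - A j) *v x)) (max (norm (B i - B j)) (norm (K i - K j)))"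
  have "{?f i j | i j. i \<le> l \<and> j \<le> l} = (\<lambda>(i, j). ?f i j) ` ({..l} \<times> {..l})" by auto
  then have "finite {?f i j | i j. i \<le> l \<and> j \<le> l}" by simp
  then have "?f i j \<le> mismatch l A B K"
    unfolding mismatch_def by (rule Max_ge) (use assms in blast)
  then have *: "onorm (\<lambda>x. (A i - A j) *v x) \<le> mismatch l A B K"
    and "norm (B i - B j) \<le> mismatch l A B K" "norm (K i - K j) \<le> mismatch l A B K" by auto
  show "norm ((A i - A j) *v x) \<le> mismatch l A B K * norm x"
    using onorm[of "\<lambda>x. (A i - A j) *v x" x] mult_right_mono[OF *, of "norm x"] by simp
  show "norm (B i - B j) \<le> mismatch l A B K" "norm (K i - K j) \<le> mismatch l A B K" by fact+
qed

lemma outer_mult_vec: "outer b k *v x = (k \<bullet> x) *\<^sub>R b"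
  unfolding outer_def matrix_vector_mult_def vec_eq_iff inner_vec_def
  by (simp add: sum_distrib_right) (simp add: mult_ac)

text \<open>One solution together with bounds uniform over the modes. With the numbers
  \<open>a\<close>, \<open>b\<close>, \<open>k\<close> as parameters, constants built from them can
  be fixed before the modes themselves are known.\<close>

locale bounded_delay_loop =
  fixes l :: nat and A :: "nat \<Rightarrow> real^'n^'n" and B K :: "nat \<Rightarrow> real^'n" and D :: real
    and sig :: "real \<Rightarrow> nat" and X0 :: "real^'n" and U0 :: "real \<Rightarrow> real"
    and X :: "real \<Rightarrow> real^'n" and U :: "real \<Rightarrow> real"
    and a b k \<epsilon> :: real
  assumes D: "D > 0" and a: "a \<ge> 0" and b: "b \<ge> 0" and k: "k \<ge> 0" and \<epsilon>: "\<epsilon> \<ge> 0"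
    and sig: "\<And>t. t \<ge> 0 \<Longrightarrow> sig t \<le> l"
    and solution: "closed_loop_solution l A B K D sig X0 U0 X U"
    and A_bound: "\<And>i x. i \<le> l \<Longrightarrow> norm (A i *v x) \<le> a * norm x"
    and B_bound: "\<And>i. i \<le> l \<Longrightarrow> norm (B i) \<le> b"
    and K_bound: "\<And>i. i \<le> l \<Longrightarrow> norm (K i) \<le> k"
    and A_diff: "\<And>i j x. i \<le> l \<Longrightarrow> j \<le> l \<Longrightarrow> norm ((A i - A j) *v x) \<le> \<epsilon> * norm x"
    and B_diff: "\<And>i j. i \<le> l \<Longrightarrow> j \<le> l \<Longrightarrow> norm (B i - B j) \<le> \<epsilon>"
    and K_diff: "\<And>i j. i \<le> l \<Longrightarrow> j \<le> l \<Longrightarrow> norm (K i - K j) \<le> \<epsilon>"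
begin

section \<open>Integrability and integral form of a solution\<close>

abbreviation "rhs s \<equiv> A (sig s) *v X s + U (s - D) *\<^sub>R B (sig s)"

lemma U_square_integrable: "(\<lambda>s. (U s)\<^sup>2) integrable_on {p..q}" if "- D \<le> p"
proof (cases "0 \<le> q")
  case True
  then have "(\<lambda>s. (U s)\<^sup>2) integrable_on {-D..q}"
    using solution by (auto simp: closed_loop_solution_def)
  then show ?thesis using that by (auto intro: integrable_on_subinterval)
next
  case False
  have "(\<lambda>s. (U s)\<^sup>2) integrable_on {-D..0}"
    using solution by (auto simp: closed_loop_solution_def)
  then show ?thesis using that False by (auto intro: integrable_on_subinterval)
qed

text \<open>On a bounded interval square integrability gives integrability, since
  \<open>\<bar>U s\<bar>\<close> is dominated by \<open>1 + (U s)\<^sup>2\<close>.\<close>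

lemma U_absolutely_integrable: "U absolutely_integrable_on {p..q}" if "- D \<le> p"
proof -
  define r where "r = max 0 q"
  have m: "U measurable_on {-D..r}" and sq: "(\<lambda>s. (U s)\<^sup>2) integrable_on {-D..r}"
    using solution by (auto simp: closed_loop_solution_def r_def)
  have "U absolutely_integrable_on {-D..r}"
  proof (rule measurable_bounded_by_integrable_imp_absolutely_integrable)
    show "U \<in> borel_measurable (lebesgue_on {-D..r})"
      using m by (simp add: measurable_on_iff_borel_measurable)
    show "(\<lambda>s. 1 + (U s)\<^sup>2) integrable_on {-D..r}" using sq by (intro integrable_add) auto
    show "norm (U s) \<le> 1 + (U s)\<^sup>2" for s
    proof -
      have "0 \<le> (\<bar>U s\<bar> - 1 / 2)\<^sup>2" by simp
      then show ?thesis by (simp add: power2_diff power_one_over)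
    qed
  qed simp
  then show ?thesis
    by (rule absolutely_integrable_on_subinterval) (use that in \<open>auto simp: r_def\<close>)
qed

lemma U_abs_integrable: "(\<lambda>s. \<bar>U s\<bar>) integrable_on {p..q}" if "- D \<le> p"
  using U_absolutely_integrable[OF that, of q] by (simp add: absolutely_integrable_on_def)

lemma U_delay_absolutely_integrable: "(\<lambda>s. U (s - D)) absolutely_integrable_on {p..q}" if "0 \<le> p"
proof -
  have *: "U integrable_on {p - D..q - D}" "(\<lambda>s. \<bar>U s\<bar>) integrable_on {p - D..q - D}"
    using U_absolutely_integrable[of "p - D" "q - D"] that by (auto simp: absolutely_integrable_on_def)
  show ?thesis
    using integrable_shift_real_ivl[OF *(1), of "- D"] integrable_shift_real_ivl[OF *(2), of "- D"]
    by (simp add: absolutely_integrable_on_def)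
qed

lemma U_delay_abs_integrable: "(\<lambda>s. \<bar>U (s - D)\<bar>) integrable_on {p..q}" if "0 \<le> p"
  using U_delay_absolutely_integrable[OF that, of q] by (simp add: absolutely_integrable_on_def)

lemma X_initial: "X 0 = X0"
proof -
  have "(rhs has_integral X 0 - X0) {0..0}" using solution by (auto simp: closed_loop_solution_def)
  then show ?thesis by (simp add: has_integral_iff)
qed

lemma X_increment: "(rhs has_integral X t - X p) {p..t}" if "0 \<le> p" "p \<le> t"
proof -
  have *: "(rhs has_integral X q - X0) {0..q}" if "q \<ge> 0" for q
    using solution that by (auto simp: closed_loop_solution_def)
  have i: "rhs integrable_on {0..t}" using *[of t] that by (auto simp: has_integral_iff)
  then have i': "rhs integrable_on {p..t}" using that by (auto intro: integrable_on_subinterval)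
  have eq: "integral {0..p} rhs + integral {p..t} rhs = integral {0..t} rhs"
    using that i by (intro Henstock_Kurzweil_Integration.integral_combine) auto
  have "X t - X p = integral {0..t} rhs - integral {0..p} rhs"
    using *[of p] *[of t] that by (simp add: has_integral_iff)
  then have "integral {p..t} rhs = X t - X p" unfolding eq[symmetric] by simp
  with i' show ?thesis unfolding has_integral_iff by blast
qed

lemma X_continuous: "continuous_on {p..t} X" if "0 \<le> p"
proof (rule continuous_on_indefinite_integral)
  show "(rhs has_integral X q - X p) {p..q}" if "q \<in> {p..t}" for q
    using X_increment[of p q] \<open>0 \<le> p\<close> that by simp
qed

lemma norm_X_integrable: "(\<lambda>s. norm (X s)) integrable_on {p..t}" if "0 \<le> p"
  by (intro integrable_continuous_real continuous_intros X_continuous that)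

text \<open>Plain integrability of \<open>rhs\<close> comes with the notion of solution; domination
  by the sizes of state and delayed input upgrades it to the absolute integrability that variation
  of constants requires.\<close>

lemma rhs_diff_absolutely_integrable: "(\<lambda>s. rhs s - N *v X s) absolutely_integrable_on {p..q}"
  if "0 \<le> p" for N :: "real^'n^'n"
proof (cases "p \<le> q")
  case True
  define c where "c = onorm ((*v) N)"
  have c: "norm (N *v x) \<le> c * norm x" for x unfolding c_def by (rule onorm) simp
  show ?thesis
  proof (rule absolutely_integrable_integrable_bound)
    show "(\<lambda>s. rhs s - N *v X s) integrable_on {p..q}"
    proof (rule integrable_diff)
      show "rhs integrable_on {p..q}" using X_increment[OF that True] by (simp add: has_integral_iff)
      show "(\<lambda>s. N *v X s) integrable_on {p..q}"
        by (intro integrable_continuous_real bounded_linear.continuous_on[OF _ X_continuous] that) simp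
    qed
    show "(\<lambda>s. (a + c) * norm (X s) + b * \<bar>U (s - D)\<bar>) integrable_on {p..q}"
      by (intro integrable_add integrable_on_mult_right norm_X_integrable U_delay_abs_integrable that)
    fix s assume s: "s \<in> {p..q}"
    have "norm (rhs s - N *v X s) \<le> norm (A (sig s) *v X s) + \<bar>U (s - D)\<bar> * norm (B (sig s)) + norm (N *v X s)"
      by (intro norm_triangle_le norm_triangle_le_diff add_mono) auto
    also have "\<dots> \<le> a * norm (X s) + \<bar>U (s - D)\<bar> * b + c * norm (X s)"
      using s that sig by (intro add_mono mult_left_mono A_bound B_bound c) auto
    finally show "norm (rhs s - N *v X s) \<le> (a + c) * norm (X s) + b * \<bar>U (s - D)\<bar>"
      by (simp add: algebra_simps)
  qed
qed simp

text \<open>The generator \<open>N\<close> is free. It is taken as \<open>A i\<close> to compare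
  with a predictor, as \<open>A 0\<close> on the initial interval, and as
  \<open>A 0 + outer (B 0) (K 0)\<close> for the decay.\<close>

lemma X_variation_of_constants:
  fixes N :: "real^'n^'n"
  assumes "0 \<le> p" "p \<le> q"
  shows "((\<lambda>s. mexp ((q - s) *\<^sub>R N) *v (rhs s - N *v X s)) has_integral
      X q - mexp ((q - p) *\<^sub>R N) *v X p) {p..q}"
proof (rule variation_of_constants[OF assms(2) rhs_diff_absolutely_integrable[OF assms(1)]])
  show "((\<lambda>s. N *v X s + (rhs s - N *v X s)) has_integral X t - X p) {p..t}" if "t \<in> {p..q}" for t
    using X_increment[of p t] assms that by simp
qed

section \<open>Prediction and feedback errors, measured by the load of a time window\<close>

definition "load p q = integral {p..q} (\<lambda>s. norm (X s) + \<bar>U (s - D)\<bar>)"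

lemma load_integrable: "(\<lambda>s. norm (X s) + \<bar>U (s - D)\<bar>) integrable_on {p..q}" if "0 \<le> p"
  by (intro integrable_add norm_X_integrable U_delay_abs_integrable that)

lemma load_eq: "load t (t + D) = integral {t..t + D} (\<lambda>s. norm (X s)) + integral {t - D..t} (\<lambda>s. \<bar>U s\<bar>)" if "0 \<le> t"
proof -
  have "integral {t..t + D} (\<lambda>s. \<bar>U (s - D)\<bar>) = integral {t - D..t} (\<lambda>s. \<bar>U s\<bar>)"
    using integral_shift_real_ivl[of t D "t + D" "\<lambda>s. \<bar>U (s - D)\<bar>"] by simp
  then show ?thesis unfolding load_def
    using Henstock_Kurzweil_Integration.integral_add[OF norm_X_integrable[OF that] U_delay_abs_integrable[OF that]]
    by simp
qed

lemma rhs_mismatch: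
  assumes "0 \<le> s" "i \<le> l"
  shows "norm (rhs s - A i *v X s - U (s - D) *\<^sub>R B i) \<le> \<epsilon> * (norm (X s) + \<bar>U (s - D)\<bar>)"
proof -
  have "rhs s - A i *v X s - U (s - D) *\<^sub>R B i = (A (sig s) - A i) *v X s + U (s - D) *\<^sub>R (B (sig s) - B i)"
    by (simp add: matrix_vector_mult_diff_rdistrib scaleR_diff_right)
  also have "norm \<dots> \<le> \<epsilon> * norm (X s) + \<bar>U (s - D)\<bar> * \<epsilon>"
    using sig assms by (intro norm_triangle_mono A_diff) (auto intro!: mult_left_mono B_diff)
  finally show ?thesis by (simp add: algebra_simps)
qed

lemma mexp_A_bound:
  assumes "i \<le> l" "0 \<le> t" "t \<le> D"
  shows "norm (mexp (t *\<^sub>R A i) *v x) \<le> exp (a * D) * norm x"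
proof -
  have "norm (mexp (t *\<^sub>R A i) *v x) \<le> exp (a * t) * norm x"
    using assms a by (intro norm_mexp_le A_bound) auto
  also have "\<dots> \<le> exp (a * D) * norm x"
    using assms a by (intro mult_right_mono) (auto simp: mult_left_mono)
  finally show ?thesis .
qed

text \<open>On \<open>{t..t + D}\<close> the plant sees exactly the inputs stored in
  \<open>{t - D..t}\<close>, so the shift by \<open>D\<close> writes state and predictor as
  integrals with the same kernel. Their difference is the kernel applied to the mode mismatch:
  \<open>exp (a * D)\<close> bounds the kernel and \<open>load\<close> collects what \<epsilon>
  multiplies.\<close>

lemma predictor_error:
  assumes "0 \<le> t" "i \<le> l"
  shows "norm (X (t + D) - pred D (A i) (B i) X U t) \<le> exp (a * D) * \<epsilon> * load t (t + D)"
proof -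
  let ?E = "\<lambda>s. mexp ((t + D - s) *\<^sub>R A i)"
  have v: "((\<lambda>s. ?E s *v (rhs s - A i *v X s)) has_integral X (t + D) - mexp (D *\<^sub>R A i) *v X t) {t..t + D}"
    using X_variation_of_constants[of t "t + D" "A i"] assms D by simp
  have contE: "continuous_on {t..t + D} ?E"
    by (rule continuous_on_compose2[OF mexp_continuous[of UNIV "A i"]]) (auto intro!: continuous_intros)
  have "(\<lambda>s. U (s - D) *\<^sub>R (?E s *v B i)) absolutely_integrable_on {t..t + D}"
  proof -
    have cE: "continuous_on {t..t + D} (\<lambda>s. ?E s *v B i)"
      by (rule bounded_linear.continuous_on[OF bounded_linear_matrix_vector_left contE])
    have "bilinear (\<lambda>(x :: real^'n) (u :: real). u *\<^sub>R x)"
      by (auto simp: bilinear_def scaleR_right_distrib scaleR_left_distrib intro!: linearI)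
    then show ?thesis
    proof (rule absolutely_integrable_bounded_measurable_product)
      show "(\<lambda>s. ?E s *v B i) \<in> borel_measurable (lebesgue_on {t..t + D})"
        using cE by (rule continuous_imp_measurable_on_sets_lebesgue) simp
      show "bounded ((\<lambda>s. ?E s *v B i) ` {t..t + D})"
        using cE by (intro compact_imp_bounded compact_continuous_image) auto
      show "(\<lambda>s. U (s - D)) absolutely_integrable_on {t..t + D}"
        using assms by (simp add: U_delay_absolutely_integrable)
    qed simp
  qed
  then have "(\<lambda>s. U (s - D) *\<^sub>R (?E s *v B i)) integrable_on {t..t + D}"
    by (simp add: absolutely_integrable_on_def)
  moreover have "integral {t..t + D} (\<lambda>s. U (s - D) *\<^sub>R (?E s *v B i))
      = integral {t - D..t} (\<lambda>\<theta>. U \<theta> *\<^sub>R (mexp ((t - \<theta>) *\<^sub>R A i) *v B i))"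
    using integral_shift_real_ivl[of t D "t + D" "\<lambda>s. U (s - D) *\<^sub>R (?E s *v B i)"] by simp
  ultimately have "((\<lambda>s. U (s - D) *\<^sub>R (?E s *v B i)) has_integral
      pred D (A i) (B i) X U t - mexp (D *\<^sub>R A i) *v X t) {t..t + D}"
    by (simp add: pred_def has_integral_iff)
  from has_integral_diff[OF v this]
  have w: "((\<lambda>s. ?E s *v (rhs s - A i *v X s - U (s - D) *\<^sub>R B i)) has_integral
      X (t + D) - pred D (A i) (B i) X U t) {t..t + D}"
    by (simp add: matrix_vector_mult_diff_distrib matrix_vector_mult_scaleR)
  have "norm (?E s *v (rhs s - A i *v X s - U (s - D) *\<^sub>R B i))
      \<le> exp (a * D) * \<epsilon> * (norm (X s) + \<bar>U (s - D)\<bar>)" if "s \<in> {t..t + D}" for s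
  proof -
    have "norm (?E s *v (rhs s - A i *v X s - U (s - D) *\<^sub>R B i))
        \<le> exp (a * D) * norm (rhs s - A i *v X s - U (s - D) *\<^sub>R B i)"
      using assms that by (intro mexp_A_bound) auto
    also have "\<dots> \<le> exp (a * D) * (\<epsilon> * (norm (X s) + \<bar>U (s - D)\<bar>))"
      using assms that by (intro mult_left_mono rhs_mismatch) auto
    finally show ?thesis by (simp add: mult.assoc)
  qed
  with w have "norm (X (t + D) - pred D (A i) (B i) X U t)
      \<le> integral {t..t + D} (\<lambda>s. exp (a * D) * \<epsilon> * (norm (X s) + \<bar>U (s - D)\<bar>))"
    by (rule has_integral_norm_bound[OF _ integrable_on_mult_right[OF load_integrable[OF assms(1)]]])
  then show ?thesis by (simp add: load_def)
qed

text \<open>Every summand of the averaged control is close to the same number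
  \<open>K 0 \<bullet> X (t + D)\<close>, one error coming from the gain and one from the
  prediction. Averaging keeps the common bound, so the number of modes does not enter.\<close>

lemma feedback_error:
  assumes "0 \<le> t"
  shows "\<bar>U t - K 0 \<bullet> X (t + D)\<bar> \<le> \<epsilon> * (norm (X (t + D)) + k * exp (a * D) * load t (t + D))"
    (is "_ \<le> ?r")
proof -
  let ?p = "\<lambda>i. pred D (A i) (B i) X U t"
  have each: "\<bar>K i \<bullet> ?p i - K 0 \<bullet> X (t + D)\<bar> \<le> ?r" if "i \<le> l" for i
  proof -
    have "K i \<bullet> ?p i - K 0 \<bullet> X (t + D) = (K i - K 0) \<bullet> X (t + D) - K i \<bullet> (X (t + D) - ?p i)"
      by (simp add: inner_diff_left inner_diff_right)
    moreover have "\<bar>(K i - K 0) \<bullet> X (t + D)\<bar> \<le> \<epsilon> * norm (X (t + D))"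
      using Cauchy_Schwarz_ineq2[of "K i - K 0" "X (t + D)"] mult_right_mono[OF K_diff[OF that, of 0], of "norm (X (t + D))"]
      by simp
    moreover have "\<bar>K i \<bullet> (X (t + D) - ?p i)\<bar> \<le> k * (exp (a * D) * \<epsilon> * load t (t + D))"
    proof -
      have "\<bar>K i \<bullet> (X (t + D) - ?p i)\<bar> \<le> norm (K i) * norm (X (t + D) - ?p i)"
        by (rule Cauchy_Schwarz_ineq2)
      also have "\<dots> \<le> k * (exp (a * D) * \<epsilon> * load t (t + D))"
        using k that assms by (intro mult_mono K_bound predictor_error) auto
      finally show ?thesis .
    qed
    ultimately show ?thesis by (simp add: algebra_simps)
  qed
  have avg: "(1 / real (l + 1)) * (\<Sum>i\<le>l. r) = r" for r :: real by simp
  have "U t = (1 / real (l + 1)) * (\<Sum>i\<le>l. K i \<bullet> ?p i)"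
    using solution assms by (auto simp: closed_loop_solution_def)
  then have eq: "U t - K 0 \<bullet> X (t + D) = (1 / real (l + 1)) * (\<Sum>i\<le>l. K i \<bullet> ?p i - K 0 \<bullet> X (t + D))"
    by (simp add: sum_subtractf field_simps)
  have "\<bar>\<Sum>i\<le>l. K i \<bullet> ?p i - K 0 \<bullet> X (t + D)\<bar> \<le> (\<Sum>i\<le>l. \<bar>K i \<bullet> ?p i - K 0 \<bullet> X (t + D)\<bar>)"
    by (rule sum_abs)
  also have "\<dots> \<le> (\<Sum>i\<le>l. ?r)" using each by (intro sum_mono) simp
  finally have "(1 / real (l + 1)) * \<bar>\<Sum>i\<le>l. K i \<bullet> ?p i - K 0 \<bullet> X (t + D)\<bar> \<le> (1 / real (l + 1)) * (\<Sum>i\<le>l. ?r)"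
    by (rule mult_left_mono) simp
  then show ?thesis unfolding eq abs_mult avg by simp
qed

text \<open>Variation of constants with mode 0 is evaluated at a point \<open>r\<close> where the
  norm of \<open>X\<close> is maximal on \<open>{0..D}\<close>. The mismatch term is then at most
  half of that maximum and is absorbed, which accounts for the factor 2.\<close>

lemma transient_bound:
  assumes small: "exp (a * D) * \<epsilon> * D \<le> 1 / 2" and "t \<in> {0..D}"
  shows "norm (X t) \<le> 2 * exp (a * D) * (norm X0 + b * integral {-D..0} (\<lambda>s. \<bar>U s\<bar>))"
proof -
  define G where "G = exp (a * D)"
  have "G > 0" by (simp add: G_def)
  define J where "J = integral {-D..0} (\<lambda>s. \<bar>U s\<bar>)"
  have "continuous_on {0..D} (\<lambda>t. norm (X t))" by (intro continuous_intros X_continuous) simp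
  then obtain r where r: "r \<in> {0..D}" and max: "\<And>s. s \<in> {0..D} \<Longrightarrow> norm (X s) \<le> norm (X r)"
    using continuous_attains_sup[of "{0..D}" "\<lambda>t. norm (X t)"] D by auto
  have v: "((\<lambda>s. mexp ((r - s) *\<^sub>R A 0) *v (rhs s - A 0 *v X s)) has_integral X r - mexp (r *\<^sub>R A 0) *v X 0) {0..r}"
    using X_variation_of_constants[of 0 r "A 0"] r by simp
  have bd: "norm (mexp ((r - s) *\<^sub>R A 0) *v (rhs s - A 0 *v X s)) \<le> G * \<epsilon> * norm (X r) + G * b * \<bar>U (s - D)\<bar>"
    if "s \<in> {0..r}" for s
  proof -
    have "norm (rhs s - A 0 *v X s) = norm ((A (sig s) - A 0) *v X s + U (s - D) *\<^sub>R B (sig s))"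
      by (simp add: matrix_vector_mult_diff_rdistrib algebra_simps)
    also have "\<dots> \<le> \<epsilon> * norm (X s) + \<bar>U (s - D)\<bar> * b"
      using sig that by (intro norm_triangle_mono A_diff) (auto intro!: mult_left_mono B_bound)
    also have "\<dots> \<le> \<epsilon> * norm (X r) + \<bar>U (s - D)\<bar> * b"
      using \<epsilon> that r by (intro add_mono mult_left_mono max) auto
    finally have "G * norm (rhs s - A 0 *v X s) \<le> G * (\<epsilon> * norm (X r) + \<bar>U (s - D)\<bar> * b)"
      using \<open>G > 0\<close> by simp
    moreover have "norm (mexp ((r - s) *\<^sub>R A 0) *v (rhs s - A 0 *v X s)) \<le> G * norm (rhs s - A 0 *v X s)"
      unfolding G_def using that r by (intro mexp_A_bound) auto
    ultimately show ?thesis by (simp add: algebra_simps)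
  qed
  have "(\<lambda>s. G * \<epsilon> * norm (X r) + G * b * \<bar>U (s - D)\<bar>) integrable_on {0..r}"
    by (intro integrable_add integrable_on_mult_right U_delay_abs_integrable) auto
  from has_integral_norm_bound[OF v this bd] have "norm (X r - mexp (r *\<^sub>R A 0) *v X 0)
      \<le> integral {0..r} (\<lambda>s. G * \<epsilon> * norm (X r) + G * b * \<bar>U (s - D)\<bar>)"
    by blast
  also have "\<dots> = G * \<epsilon> * norm (X r) * r + G * b * integral {0..r} (\<lambda>s. \<bar>U (s - D)\<bar>)"
    using U_delay_abs_integrable[of 0 r] r
    by (subst Henstock_Kurzweil_Integration.integral_add) (auto intro!: integrable_on_mult_right simp: mult.commute)
  also have "integral {0..r} (\<lambda>s. \<bar>U (s - D)\<bar>) \<le> J"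
  proof -
    have "integral {0..r} (\<lambda>s. \<bar>U (s - D)\<bar>) \<le> integral {0..D} (\<lambda>s. \<bar>U (s - D)\<bar>)"
      using r by (intro integral_subset_le U_delay_abs_integrable) auto
    also have "\<dots> = J"
      unfolding J_def using integral_shift_real_ivl[of 0 D D "\<lambda>s. \<bar>U (s - D)\<bar>"] by simp
    finally show ?thesis .
  qed
  finally have 1: "norm (X r - mexp (r *\<^sub>R A 0) *v X 0) \<le> G * \<epsilon> * norm (X r) * r + G * b * J"
    using b \<open>G > 0\<close> by (simp add: mult_left_mono)
  have "G * \<epsilon> * r \<le> G * \<epsilon> * D" using r \<open>G > 0\<close> \<epsilon> by (intro mult_left_mono) auto
  then have "G * \<epsilon> * r * norm (X r) \<le> 1 / 2 * norm (X r)"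
    using small unfolding G_def[symmetric] by (intro mult_right_mono) auto
  then have "G * \<epsilon> * norm (X r) * r \<le> norm (X r) / 2" by (simp add: mult_ac)
  moreover have "norm (mexp (r *\<^sub>R A 0) *v X 0) \<le> G * norm X0"
    unfolding G_def X_initial using r by (intro mexp_A_bound) auto
  moreover have "norm (X r) \<le> norm (X r - mexp (r *\<^sub>R A 0) *v X 0) + norm (mexp (r *\<^sub>R A 0) *v X 0)"
    using norm_triangle_sub by (metis add.commute)
  ultimately have "norm (X r) \<le> 2 * G * (norm X0 + b * J)"
    using 1 by (simp add: algebra_simps)
  then show ?thesis using max[OF assms(2)] unfolding G_def J_def by linarith
qed

section \<open>Exponentially weighted bounds on a finite horizon\<close>

definition "past_input = integral {-D..0} (\<lambda>s. \<bar>U s\<bar>)"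

lemma past_input_nonneg: "past_input \<ge> 0"
  unfolding past_input_def by (rule integral_nonneg) (use U_abs_integrable in auto)

text \<open>A window of length \<open>D\<close> costs a factor of order \<open>D\<close>, and inputs
  up to \<open>D\<close> earlier cost \<open>exp (\<xi> * D)\<close>. Inputs before time 0 have no
  pointwise bound and are accounted for by \<open>past_input\<close>.\<close>

lemma load_decay:
  assumes "\<xi> > 0" and "N \<ge> 0" and t: "t \<in> {0..T}"
    and XN: "\<And>t. t \<in> {0..T + D} \<Longrightarrow> norm (X t) \<le> N * exp (- \<xi> * t)"
    and UN: "\<And>t. t \<in> {0..T} \<Longrightarrow> \<bar>U t\<bar> \<le> N * exp (- \<xi> * t)"
  shows "load t (t + D) \<le> exp (- \<xi> * t) * (exp (\<xi> * D) * (1 + 2 * D) * (N + past_input))"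
proof -
  define h where "h = exp (\<xi> * D)"
  define e where "e = exp (- \<xi> * t)"
  have "h \<ge> 1" "e > 0" using assms D by (auto simp: h_def e_def)
  have he: "h * e = exp (\<xi> * (D - t))" by (simp add: h_def e_def exp_add[symmetric] algebra_simps)
  have "integral {t..t + D} (\<lambda>s. norm (X s)) \<le> N * e * (t + D - t)"
  proof (rule integral_le_const)
    fix s assume s: "s \<in> {t..t + D}"
    have "norm (X s) \<le> N * exp (- \<xi> * s)" using s t by (intro XN) auto
    also have "\<dots> \<le> N * e" unfolding e_def using s \<open>\<xi> > 0\<close> \<open>N \<ge> 0\<close> by (intro mult_left_mono) auto
    finally show "norm (X s) \<le> N * e" .
  qed (use D t norm_X_integrable in auto)
  moreover have "integral {t - D..t} (\<lambda>s. \<bar>U s\<bar>) \<le> h * e * (past_input + D * N)"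
  \<comment> \<open>For \<open>t \<le> D\<close> the window reaches the initial input, and
    \<open>h * e \<ge> 1\<close> lets the undecayed bound be written with the decaying weight; for
    later \<open>t\<close> the bound \<open>UN\<close> covers the whole window.\<close>
  proof (cases "t \<le> D")
    case True
    have "integral {t - D..t} (\<lambda>s. \<bar>U s\<bar>) = integral {t - D..0} (\<lambda>s. \<bar>U s\<bar>) + integral {0..t} (\<lambda>s. \<bar>U s\<bar>)"
      using True t U_abs_integrable[of "t - D" t]
      by (intro Henstock_Kurzweil_Integration.integral_combine[symmetric]) auto
    also have "\<dots> \<le> past_input + N * (t - 0)"
    proof (rule add_mono)
      show "integral {t - D..0} (\<lambda>s. \<bar>U s\<bar>) \<le> past_input"
        unfolding past_input_def using t by (intro integral_subset_le U_abs_integrable) auto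
      show "integral {0..t} (\<lambda>s. \<bar>U s\<bar>) \<le> N * (t - 0)"
      proof (rule integral_le_const)
        fix s assume s: "s \<in> {0..t}"
        have "\<bar>U s\<bar> \<le> N * exp (- \<xi> * s)" using s t by (intro UN) auto
        also have "\<dots> \<le> N * 1" using s \<open>\<xi> > 0\<close> \<open>N \<ge> 0\<close> by (intro mult_left_mono) auto
        finally show "\<bar>U s\<bar> \<le> N" by simp
      qed (use D t U_abs_integrable in auto)
    qed
    also have "\<dots> \<le> 1 * (past_input + D * N)" using mult_left_mono[OF True \<open>N \<ge> 0\<close>] by (simp add: mult.commute)
    also have "\<dots> \<le> h * e * (past_input + D * N)"
      unfolding he using True \<open>\<xi> > 0\<close> \<open>N \<ge> 0\<close> past_input_nonneg D by (intro mult_right_mono) auto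
    finally show ?thesis .
  next
    case False
    have "integral {t - D..t} (\<lambda>s. \<bar>U s\<bar>) \<le> N * (h * e) * (t - (t - D))"
    proof (rule integral_le_const)
      fix s assume s: "s \<in> {t - D..t}"
      have "\<bar>U s\<bar> \<le> N * exp (- \<xi> * s)" using s t False by (intro UN) auto
      also have "\<dots> \<le> N * exp (\<xi> * (D - t))"
      proof -
        have "\<xi> * (t - D) \<le> \<xi> * s" using s \<open>\<xi> > 0\<close> by (intro mult_left_mono) auto
        then show ?thesis using \<open>N \<ge> 0\<close> by (intro mult_left_mono) (auto simp: algebra_simps)
      qed
      finally show "\<bar>U s\<bar> \<le> N * (h * e)" unfolding he .
    qed (use D t False U_abs_integrable in auto)
    also have "\<dots> \<le> h * e * (past_input + D * N)"
      using past_input_nonneg \<open>h \<ge> 1\<close> \<open>e > 0\<close> by (simp add: algebra_simps)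
    finally show ?thesis .
  qed
  ultimately have "load t (t + D) \<le> e * (D * N + h * (past_input + D * N))"
    using load_eq[of t] t by (simp add: distrib_left distrib_right mult_ac)
  also have "D * N + h * (past_input + D * N) \<le> h * (1 + 2 * D) * (N + past_input)"
  proof -
    have "1 * (D * N) \<le> h * (D * N)" using \<open>h \<ge> 1\<close> D \<open>N \<ge> 0\<close> by (intro mult_right_mono) auto
    moreover have "0 \<le> h * (N + 2 * D * past_input)" using \<open>h \<ge> 1\<close> D \<open>N \<ge> 0\<close> past_input_nonneg by auto
    ultimately show ?thesis by (simp add: algebra_simps)
  qed
  finally show ?thesis using \<open>e > 0\<close> unfolding e_def h_def by simp
qed

text \<open>Weighted bounds \<open>N\<close> yield bounds \<open>N'\<close> on the same intervals,
  in which \<open>N\<close> occurs only with a factor \<epsilon>. \<open>C1\<close> collects the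
  feedback error, \<open>C2\<close> the perturbation of the equation with generator
  \<open>A 0 + outer (B 0) (K 0)\<close>, and \<open>C3\<close> their joint effect on state and
  input.\<close>

lemma bootstrap:
  assumes "\<xi> > 0" and "N \<ge> 0" and "T \<ge> 0" and "c \<ge> 1" and "m \<ge> 0"
    and stab: "\<And>t x. t \<ge> 0 \<Longrightarrow>
      norm (mexp (t *\<^sub>R (A 0 + outer (B 0) (K 0))) *v x) \<le> c * exp (- (2 * \<xi>) * t) * norm x"
    and h_def: "h = exp (\<xi> * D)"
    and C1_def: "C1 = 1 + k * exp (a * D) * (h * (1 + 2 * D))"
    and C2_def: "C2 = 1 + h + b * h * C1"
    and C3_def: "C3 = (1 + k) * c * C2 / \<xi> + C1"
    and Xm: "\<And>t. t \<in> {0..D} \<Longrightarrow> norm (X t) \<le> m"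
    and XN: "\<And>t. t \<in> {0..T + D} \<Longrightarrow> norm (X t) \<le> N * exp (- \<xi> * t)"
    and UN: "\<And>t. t \<in> {0..T} \<Longrightarrow> \<bar>U t\<bar> \<le> N * exp (- \<xi> * t)"
  defines "N' \<equiv> (1 + k) * c * h * m + \<epsilon> * C3 * (N + past_input)"
  shows "\<And>t. t \<in> {0..T + D} \<Longrightarrow> norm (X t) \<le> N' * exp (- \<xi> * t)"
    and "\<And>t. t \<in> {0..T} \<Longrightarrow> \<bar>U t\<bar> \<le> N' * exp (- \<xi> * t)"
proof -
  define W where "W = N + past_input"
  have "W \<ge> 0" "N \<le> W" using past_input_nonneg \<open>N \<ge> 0\<close> by (auto simp: W_def)
  have "h \<ge> 1" using \<open>\<xi> > 0\<close> D by (simp add: h_def)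
  have "C1 \<ge> 1" unfolding C1_def using k D \<open>h \<ge> 1\<close> by auto
  have "C2 \<ge> 1" unfolding C2_def using b \<open>h \<ge> 1\<close> \<open>C1 \<ge> 1\<close> by auto
  define e where "e t = U t - K 0 \<bullet> X (t + D)" for t
  have e: "\<bar>e t\<bar> \<le> \<epsilon> * C1 * W * exp (- \<xi> * t)" if t: "t \<in> {0..T}" for t
  proof -
    have "norm (X (t + D)) \<le> W * exp (- \<xi> * t)"
    proof -
      have "norm (X (t + D)) \<le> N * exp (- \<xi> * (t + D))" using t D by (intro XN) auto
      also have "\<dots> \<le> W * exp (- \<xi> * t)"
        using \<open>N \<le> W\<close> \<open>N \<ge> 0\<close> \<open>\<xi> > 0\<close> D by (intro mult_mono) auto
      finally show ?thesis .
    qed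
    moreover have "k * exp (a * D) * load t (t + D)
        \<le> k * exp (a * D) * (exp (- \<xi> * t) * (h * (1 + 2 * D) * W))"
      unfolding h_def W_def using k t assms by (intro mult_left_mono load_decay) auto
    ultimately have "norm (X (t + D)) + k * exp (a * D) * load t (t + D) \<le> C1 * W * exp (- \<xi> * t)"
      by (simp add: C1_def algebra_simps)
    then have "\<epsilon> * (norm (X (t + D)) + k * exp (a * D) * load t (t + D)) \<le> \<epsilon> * (C1 * W * exp (- \<xi> * t))"
      using \<epsilon> by (rule mult_left_mono)
    then show ?thesis using feedback_error[of t] t by (simp add: e_def mult.assoc)
  qed
  let ?M = "A 0 + outer (B 0) (K 0)"
  have g: "norm (rhs s - ?M *v X s) \<le> \<epsilon> * C2 * W * exp (- \<xi> * s)" if s: "s \<in> {D..T + D}" for s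
  proof -
    have hs: "exp (- \<xi> * (s - D)) = h * exp (- \<xi> * s)"
      by (simp add: h_def exp_add[symmetric] algebra_simps)
    \<comment> \<open>For \<open>s \<ge> D\<close> the delayed input is
      \<open>K 0 \<bullet> X s + e (s - D)\<close>: the delay cancels the prediction, and the
      nominal feedback moves into \<open>?M\<close>.\<close>
    have "rhs s - ?M *v X s = (rhs s - A 0 *v X s - U (s - D) *\<^sub>R B 0) + e (s - D) *\<^sub>R B 0"
      by (simp add: e_def matrix_vector_mult_add_rdistrib outer_mult_vec algebra_simps)
    also have "norm \<dots> \<le> \<epsilon> * (norm (X s) + \<bar>U (s - D)\<bar>) + \<bar>e (s - D)\<bar> * norm (B 0)"
      using s D by (intro norm_triangle_mono rhs_mismatch) auto
    also have "\<dots> \<le> \<epsilon> * (W * exp (- \<xi> * s) + W * (h * exp (- \<xi> * s)))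
        + (\<epsilon> * C1 * W * (h * exp (- \<xi> * s))) * b"
    proof (intro add_mono mult_left_mono mult_mono)
      have "norm (X s) \<le> N * exp (- \<xi> * s)" using s D by (intro XN) auto
      also have "\<dots> \<le> W * exp (- \<xi> * s)" using \<open>N \<le> W\<close> by (intro mult_right_mono) auto
      finally show "norm (X s) \<le> W * exp (- \<xi> * s)" .
      have "\<bar>U (s - D)\<bar> \<le> N * exp (- \<xi> * (s - D))" using s by (intro UN) auto
      also have "\<dots> \<le> W * exp (- \<xi> * (s - D))" using \<open>N \<le> W\<close> by (intro mult_right_mono) auto
      finally show "\<bar>U (s - D)\<bar> \<le> W * (h * exp (- \<xi> * s))" unfolding hs .
      show "\<bar>e (s - D)\<bar> \<le> \<epsilon> * C1 * W * (h * exp (- \<xi> * s))"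
        using e[of "s - D"] s unfolding hs by auto
      show "norm (B 0) \<le> b" by (rule B_bound) simp
      show "0 \<le> \<epsilon> * C1 * W * (h * exp (- \<xi> * s))"
        using \<epsilon> \<open>C1 \<ge> 1\<close> \<open>W \<ge> 0\<close> \<open>h \<ge> 1\<close> by auto
    qed (use \<epsilon> in auto)
    also have "\<dots> = \<epsilon> * C2 * W * exp (- \<xi> * s)" by (simp add: C2_def algebra_simps)
    finally show ?thesis .
  qed
  \<comment> \<open>\<open>N1\<close> bounds the state alone. The input needs \<open>k * N1\<close>
    plus the feedback error, and \<open>N'\<close> is chosen to dominate both.\<close>
  define N1 where "N1 = c * h * m + \<epsilon> * (c * C2 / \<xi>) * W"
  have X1: "norm (X t) \<le> N1 * exp (- \<xi> * t)" if t: "t \<in> {0..T + D}" for t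
  proof (cases "t \<le> D")
    case True
    have "1 \<le> h * exp (- \<xi> * t)"
      using True \<open>\<xi> > 0\<close> by (simp add: h_def exp_add[symmetric] mult_left_mono)
    then have "1 * 1 \<le> c * (h * exp (- \<xi> * t))" using \<open>c \<ge> 1\<close> by (intro mult_mono) auto
    then have "m * 1 \<le> m * (c * (h * exp (- \<xi> * t)))" using \<open>m \<ge> 0\<close> by (intro mult_left_mono) auto
    moreover have "0 \<le> \<epsilon> * (c * C2 / \<xi>) * W * exp (- \<xi> * t)"
      using \<epsilon> \<open>c \<ge> 1\<close> \<open>C2 \<ge> 1\<close> \<open>\<xi> > 0\<close> \<open>W \<ge> 0\<close> by auto
    ultimately have "m \<le> N1 * exp (- \<xi> * t)" by (simp add: N1_def algebra_simps)
    then show ?thesis using Xm[of t] t True by auto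
  next
    case False
    define R where "R = c * \<epsilon> * C2 * W * exp (- \<xi> * t)"
    have "R \<ge> 0" unfolding R_def using \<epsilon> \<open>c \<ge> 1\<close> \<open>C2 \<ge> 1\<close> \<open>W \<ge> 0\<close> by auto
    have v: "((\<lambda>s. mexp ((t - s) *\<^sub>R ?M) *v (rhs s - ?M *v X s)) has_integral
        X t - mexp ((t - D) *\<^sub>R ?M) *v X D) {D..t}"
      using X_variation_of_constants[of D t ?M] False D by simp
    have ei: "((\<lambda>s. R * exp (- \<xi> * (t - s))) has_integral
        R / \<xi> * exp (- \<xi> * (t - t)) - R / \<xi> * exp (- \<xi> * (t - D))) {D..t}"
    proof (rule fundamental_theorem_of_calculus)
      show "((\<lambda>s. R / \<xi> * exp (- \<xi> * (t - s))) has_vector_derivative R * exp (- \<xi> * (t - x))) (at x within {D..t})" for x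
        unfolding has_real_derivative_iff_has_vector_derivative[symmetric]
        using \<open>\<xi> > 0\<close> by (auto intro!: derivative_eq_intros)
    qed (use False in auto)
    have "norm (mexp ((t - s) *\<^sub>R ?M) *v (rhs s - ?M *v X s)) \<le> R * exp (- \<xi> * (t - s))"
      if s: "s \<in> {D..t}" for s
    proof -
      have "norm (mexp ((t - s) *\<^sub>R ?M) *v (rhs s - ?M *v X s))
          \<le> c * exp (- (2 * \<xi>) * (t - s)) * norm (rhs s - ?M *v X s)"
        using s by (intro stab) auto
      also have "\<dots> \<le> c * exp (- (2 * \<xi>) * (t - s)) * (\<epsilon> * C2 * W * exp (- \<xi> * s))"
        using s t \<open>c \<ge> 1\<close> by (intro mult_left_mono g) auto
      also have "\<dots> = c * \<epsilon> * C2 * W * (exp (- (2 * \<xi>) * (t - s)) * exp (- \<xi> * s))"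
        by (simp add: mult_ac)
      \<comment> \<open>Half of the rate \<open>2 * \<xi>\<close> produces the target weight at time
        \<open>t\<close>; the other half remains in the integral over \<open>s\<close>, which is
        then at most \<open>1 / \<xi>\<close>.\<close>
      also have "exp (- (2 * \<xi>) * (t - s)) * exp (- \<xi> * s) = exp (- \<xi> * t) * exp (- \<xi> * (t - s))"
        by (simp add: exp_add[symmetric] algebra_simps)
      finally show ?thesis by (simp add: R_def mult.assoc)
    qed
    then have "norm (X t - mexp ((t - D) *\<^sub>R ?M) *v X D) \<le> integral {D..t} (\<lambda>s. R * exp (- \<xi> * (t - s)))"
      using ei by (intro has_integral_norm_bound[OF v]) (auto simp: has_integral_iff)
    also have "\<dots> \<le> R / \<xi>"
      using ei \<open>R \<ge> 0\<close> \<open>\<xi> > 0\<close> by (simp add: has_integral_iff)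
    finally have 1: "norm (X t - mexp ((t - D) *\<^sub>R ?M) *v X D) \<le> R / \<xi>" .
    have "norm (mexp ((t - D) *\<^sub>R ?M) *v X D) \<le> c * exp (- (2 * \<xi>) * (t - D)) * norm (X D)"
      using False by (intro stab) auto
    also have "\<dots> \<le> c * (h * exp (- \<xi> * t)) * m"
    proof (intro mult_mono)
      have "\<xi> * D \<le> \<xi> * t" using False \<open>\<xi> > 0\<close> by (intro mult_left_mono) auto
      then show "exp (- (2 * \<xi>) * (t - D)) \<le> h * exp (- \<xi> * t)"
        by (simp add: h_def exp_add[symmetric] algebra_simps)
      show "norm (X D) \<le> m" using Xm[of D] D by simp
    qed (use \<open>c \<ge> 1\<close> \<open>h \<ge> 1\<close> in auto)
    finally have "norm (mexp ((t - D) *\<^sub>R ?M) *v X D) \<le> c * (h * exp (- \<xi> * t)) * m" .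
    moreover have "norm (X t) \<le> norm (X t - mexp ((t - D) *\<^sub>R ?M) *v X D) + norm (mexp ((t - D) *\<^sub>R ?M) *v X D)"
      using norm_triangle_sub by (metis add.commute)
    ultimately have "norm (X t) \<le> R / \<xi> + c * (h * exp (- \<xi> * t)) * m" using 1 by linarith
    also have "\<dots> = N1 * exp (- \<xi> * t)" by (simp add: R_def N1_def algebra_simps)
    finally show ?thesis .
  qed
  have "N1 \<ge> 0" unfolding N1_def
    using \<epsilon> \<open>c \<ge> 1\<close> \<open>C2 \<ge> 1\<close> \<open>\<xi> > 0\<close> \<open>W \<ge> 0\<close> \<open>h \<ge> 1\<close> \<open>m \<ge> 0\<close> by auto
  have N': "N' = (1 + k) * N1 + \<epsilon> * C1 * W"
    using \<open>\<xi> > 0\<close> by (simp add: N'_def N1_def C3_def W_def field_simps)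
  have CW: "0 \<le> \<epsilon> * C1 * W" using \<epsilon> \<open>C1 \<ge> 1\<close> \<open>W \<ge> 0\<close> by auto
  show "norm (X t) \<le> N' * exp (- \<xi> * t)" if "t \<in> {0..T + D}" for t
  proof -
    have "0 \<le> k * N1" using k \<open>N1 \<ge> 0\<close> by simp
    then have "N1 \<le> N'" using CW by (simp add: N' algebra_simps)
    then have "N1 * exp (- \<xi> * t) \<le> N' * exp (- \<xi> * t)" by (intro mult_right_mono) auto
    then show ?thesis using X1[OF that] by linarith
  qed
  show "\<bar>U t\<bar> \<le> N' * exp (- \<xi> * t)" if t: "t \<in> {0..T}" for t
  proof -
    have "\<bar>K 0 \<bullet> X (t + D)\<bar> \<le> norm (K 0) * norm (X (t + D))" by (rule Cauchy_Schwarz_ineq2)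
    also have "\<dots> \<le> k * (N1 * exp (- \<xi> * t))"
    proof (intro mult_mono K_bound)
      have "norm (X (t + D)) \<le> N1 * exp (- \<xi> * (t + D))" using t D by (intro X1) auto
      also have "\<dots> \<le> N1 * exp (- \<xi> * t)"
        using \<open>N1 \<ge> 0\<close> \<open>\<xi> > 0\<close> D by (intro mult_left_mono) auto
      finally show "norm (X (t + D)) \<le> N1 * exp (- \<xi> * t)" .
    qed (use k in auto)
    finally have "\<bar>U t\<bar> \<le> k * (N1 * exp (- \<xi> * t)) + \<epsilon> * C1 * W * exp (- \<xi> * t)"
      using e[OF t] unfolding e_def by linarith
    also have "\<dots> \<le> N' * exp (- \<xi> * t)"
    proof -
      have "0 \<le> N1 * exp (- \<xi> * t)" using \<open>N1 \<ge> 0\<close> by simp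
      then show ?thesis by (simp add: N' algebra_simps)
    qed
    finally show ?thesis .
  qed
qed

text \<open>The least weighted bound \<open>n\<close> on the horizon is put into the bootstrap. The
  resulting \<open>N\<close> does not involve the length of the horizon beyond the weight at
  \<open>T\<close>, so the estimate holds at every time.\<close>

lemma exponential_decay:
  assumes "\<xi> > 0" and "T \<ge> 0" and "c \<ge> 1"
    and stab: "\<And>t x. t \<ge> 0 \<Longrightarrow>
      norm (mexp (t *\<^sub>R (A 0 + outer (B 0) (K 0))) *v x) \<le> c * exp (- (2 * \<xi>) * t) * norm x"
    and h_def: "h = exp (\<xi> * D)"
    and C1_def: "C1 = 1 + k * exp (a * D) * (h * (1 + 2 * D))"
    and C2_def: "C2 = 1 + h + b * h * C1"
    and C3_def: "C3 = (1 + k) * c * C2 / \<xi> + C1"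
    and small: "exp (a * D) * \<epsilon> * D \<le> 1 / 2" "\<epsilon> * C3 \<le> 1 / 2"
  defines "N \<equiv> 2 * ((1 + k) * c * h * (2 * exp (a * D) * (norm X0 + b * past_input))) + past_input"
  shows "norm (X T) \<le> N * exp (- \<xi> * T)" and "\<bar>U T\<bar> \<le> N * exp (- \<xi> * T)"
proof -
  define m where "m = 2 * exp (a * D) * (norm X0 + b * past_input)"
  have "m \<ge> 0" unfolding m_def using b past_input_nonneg by auto
  have Xm: "norm (X t) \<le> m" if "t \<in> {0..D}" for t
    using transient_bound[OF small(1) that] by (simp add: m_def past_input_def)
  define Z where "Z = (\<lambda>t. exp (\<xi> * t) * norm (X t)) ` {0..T + D} \<union> (\<lambda>t. exp (\<xi> * t) * \<bar>U t\<bar>) ` {0..T}"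
  have "continuous_on {0..T + D} (\<lambda>t. norm (X t))" by (intro continuous_intros X_continuous) simp
  then obtain x where x: "\<And>t. t \<in> {0..T + D} \<Longrightarrow> norm (X t) \<le> x"
    using continuous_attains_sup[of "{0..T + D}" "\<lambda>t. norm (X t)"] D \<open>T \<ge> 0\<close> by fastforce
  \<comment> \<open>A crude bound, dependent on \<open>T\<close>, that serves only to make the
    supremum of \<open>Z\<close> finite; without it the absorption below would be
    meaningless.\<close>
  define u where "u = k * x + \<epsilon> * (x + k * exp (a * D) * load 0 (T + D))"
  have u: "\<bar>U t\<bar> \<le> u" if t: "t \<in> {0..T}" for t
  proof -
    have "\<bar>K 0 \<bullet> X (t + D)\<bar> \<le> norm (K 0) * norm (X (t + D))" by (rule Cauchy_Schwarz_ineq2)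
    also have "\<dots> \<le> k * x" using t D k by (intro mult_mono K_bound x) auto
    finally have "\<bar>U t\<bar> \<le> k * x + \<bar>U t - K 0 \<bullet> X (t + D)\<bar>" by linarith
    also have "\<bar>U t - K 0 \<bullet> X (t + D)\<bar> \<le> \<epsilon> * (norm (X (t + D)) + k * exp (a * D) * load t (t + D))"
      using t by (intro feedback_error) auto
    also have "\<dots> \<le> \<epsilon> * (x + k * exp (a * D) * load 0 (T + D))"
    proof (intro mult_left_mono add_mono x)
      show "load t (t + D) \<le> load 0 (T + D)"
        unfolding load_def using t D by (intro integral_subset_le load_integrable) auto
    qed (use t D k \<epsilon> in auto)
    finally show ?thesis by (simp add: u_def)
  qed
  have "exp (\<xi> * t) * y \<le> exp (\<xi> * (T + D)) * v" if "t \<le> T + D" "y \<le> v" "0 \<le> y" for t y v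
    using that \<open>\<xi> > 0\<close> by (intro mult_mono) auto
  then have "z \<le> exp (\<xi> * (T + D)) * max x u" if "z \<in> Z" for z
    using that x u D unfolding Z_def by (fastforce simp: le_max_iff_disj)
  then have bdd: "bdd_above Z" by (meson bdd_above.I)
  define n where "n = Sup Z"
  have "exp (\<xi> * 0) * norm (X 0) \<in> Z" unfolding Z_def using D \<open>T \<ge> 0\<close> by (intro UnI1 imageI) auto
  then have "norm (X 0) \<le> n" and "Z \<noteq> {}" unfolding n_def using cSup_upper[OF _ bdd] by auto
  then have "n \<ge> 0" using norm_ge_zero[of "X 0"] by linarith
  have weight: "y \<le> n' * exp (- \<xi> * t) \<longleftrightarrow> exp (\<xi> * t) * y \<le> n'" for y n' t :: real
    by (simp add: exp_minus field_simps)
  have XN: "norm (X t) \<le> n * exp (- \<xi> * t)" if "t \<in> {0..T + D}" for t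
    unfolding weight n_def using that by (intro cSup_upper bdd) (auto simp: Z_def)
  have UN: "\<bar>U t\<bar> \<le> n * exp (- \<xi> * t)" if "t \<in> {0..T}" for t
    unfolding weight n_def using that by (intro cSup_upper bdd) (auto simp: Z_def)
  note boot = bootstrap[OF \<open>\<xi> > 0\<close> \<open>n \<ge> 0\<close> \<open>T \<ge> 0\<close> \<open>c \<ge> 1\<close> \<open>m \<ge> 0\<close> stab h_def C1_def C2_def C3_def Xm XN UN,
      unfolded weight]
  have "n \<le> (1 + k) * c * h * m + \<epsilon> * C3 * (n + past_input)"
    unfolding n_def[unfolded Z_def]
    using boot \<open>Z \<noteq> {}\<close> by (intro cSup_least) (auto simp: n_def Z_def)
  \<comment> \<open>Half of \<open>n\<close> moves to the left; doubling the rest leaves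
    \<open>past_input\<close> with coefficient 1, whence the form of \<open>N\<close>.\<close>
  moreover have "\<epsilon> * C3 * (n + past_input) \<le> 1 / 2 * (n + past_input)"
    using small(2) \<open>n \<ge> 0\<close> past_input_nonneg by (intro mult_right_mono) auto
  ultimately have "n \<le> N" by (simp add: N_def m_def)
  then have "n * exp (- \<xi> * T) \<le> N * exp (- \<xi> * T)" by (intro mult_right_mono) auto
  then show "norm (X T) \<le> N * exp (- \<xi> * T)" "\<bar>U T\<bar> \<le> N * exp (- \<xi> * T)"
    using XN[of T] UN[of T] D \<open>T \<ge> 0\<close> by (auto intro: order_trans)
qed

text \<open>For \<open>t \<le> D\<close> the window overlaps the initial interval, whose energy is
  kept as it is because \<open>E \<ge> 1\<close> there; everything after time 0 is bounded pointwise
  and contributes at most \<open>D\<close> times a squared supremum.\<close>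

lemma input_energy_decay:
  assumes "\<xi> > 0" and "N \<ge> 0" and "t \<ge> 0"
    and UN: "\<And>s. s \<ge> 0 \<Longrightarrow> \<bar>U s\<bar> \<le> N * exp (- \<xi> * s)"
  shows "sqrt (integral {t - D..t} (\<lambda>s. (U s)\<^sup>2))
    \<le> exp (\<xi> * D) * (sqrt (integral {-D..0} (\<lambda>s. (U s)\<^sup>2)) + sqrt D * N) * exp (- \<xi> * t)"
proof -
  define S where "S = sqrt (integral {-D..0} (\<lambda>s. (U s)\<^sup>2))"
  have nn: "integral {-D..0} (\<lambda>s. (U s)\<^sup>2) \<ge> 0" by (rule integral_nonneg) (use U_square_integrable in auto)
  then have "S \<ge> 0" and S2: "integral {-D..0} (\<lambda>s. (U s)\<^sup>2) = S\<^sup>2" by (auto simp: S_def)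
  define E where "E = exp (\<xi> * (D - t))"
  have "E > 0" by (simp add: E_def)
  have E: "exp (\<xi> * D) * exp (- \<xi> * t) = E" by (simp add: E_def exp_add[symmetric] algebra_simps)
  have U2: "(U s)\<^sup>2 \<le> (N * exp (- \<xi> * r))\<^sup>2" if "s \<ge> 0" "s \<ge> r" for s r
  proof -
    have "\<bar>U s\<bar> \<le> N * exp (- \<xi> * s)" using that by (intro UN)
    also have "\<dots> \<le> N * exp (- \<xi> * r)" using that \<open>\<xi> > 0\<close> \<open>N \<ge> 0\<close> by (intro mult_left_mono) auto
    finally show ?thesis by (simp add: abs_le_square_iff[symmetric])
  qed
  have "integral {t - D..t} (\<lambda>s. (U s)\<^sup>2) \<le> E\<^sup>2 * (S\<^sup>2 + D * N\<^sup>2)"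
  proof (cases "t \<le> D")
    case True
    have "integral {t - D..t} (\<lambda>s. (U s)\<^sup>2) = integral {t - D..0} (\<lambda>s. (U s)\<^sup>2) + integral {0..t} (\<lambda>s. (U s)\<^sup>2)"
      using True \<open>t \<ge> 0\<close> U_square_integrable[of "t - D" t]
      by (intro Henstock_Kurzweil_Integration.integral_combine[symmetric]) auto
    also have "\<dots> \<le> S\<^sup>2 + N\<^sup>2 * (t - 0)"
    proof (rule add_mono)
      show "integral {t - D..0} (\<lambda>s. (U s)\<^sup>2) \<le> S\<^sup>2"
        unfolding S2[symmetric] using \<open>t \<ge> 0\<close> by (intro integral_subset_le U_square_integrable) auto
      show "integral {0..t} (\<lambda>s. (U s)\<^sup>2) \<le> N\<^sup>2 * (t - 0)"
        using U2[of _ 0] \<open>t \<ge> 0\<close> D by (intro integral_le_const U_square_integrable) auto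
    qed
    also have "\<dots> \<le> 1 * (S\<^sup>2 + D * N\<^sup>2)" using mult_left_mono[OF True, of "N\<^sup>2"] by (simp add: mult.commute)
    also have "\<dots> \<le> E\<^sup>2 * (S\<^sup>2 + D * N\<^sup>2)"
    proof (rule mult_right_mono)
      have "E \<ge> 1" using True \<open>\<xi> > 0\<close> by (simp add: E_def)
      then show "1 \<le> E\<^sup>2" by simp
    qed (use D in auto)
    finally show ?thesis .
  next
    case False
    have "integral {t - D..t} (\<lambda>s. (U s)\<^sup>2) \<le> (N * exp (- \<xi> * (t - D)))\<^sup>2 * (t - (t - D))"
      using U2[of _ "t - D"] \<open>t \<ge> 0\<close> D False by (intro integral_le_const U_square_integrable) auto
    also have "exp (- \<xi> * (t - D)) = E" by (simp add: E_def algebra_simps)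
    also have "(N * E)\<^sup>2 * (t - (t - D)) \<le> E\<^sup>2 * (S\<^sup>2 + D * N\<^sup>2)"
      by (simp add: power_mult_distrib algebra_simps)
    finally show ?thesis .
  qed
  also have "\<dots> \<le> (E * (S + sqrt D * N))\<^sup>2"
  proof -
    have "0 \<le> 2 * S * (sqrt D * N)" using \<open>S \<ge> 0\<close> \<open>N \<ge> 0\<close> D by auto
    then have "S\<^sup>2 + D * N\<^sup>2 \<le> (S + sqrt D * N)\<^sup>2" using D by (simp add: power2_sum power_mult_distrib)
    then show ?thesis by (simp add: power_mult_distrib mult_left_mono)
  qed
  finally have "sqrt (integral {t - D..t} (\<lambda>s. (U s)\<^sup>2)) \<le> E * (S + sqrt D * N)"
    using \<open>E > 0\<close> \<open>S \<ge> 0\<close> \<open>N \<ge> 0\<close> D by (intro real_le_lsqrt) auto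
  then show ?thesis unfolding S_def E[symmetric] by (simp add: mult_ac)
qed

end

text \<open>The threshold is chosen knowing mode 0 but before the remaining modes. If it could
  depend on the whole family, any value not exceeding a positive mismatch would make the implication
  vacuous. The \<rho> and \<xi> constructed are the same for all initial data.\<close>

theorem theorem2p1:
  fixes l :: nat and D tau_d :: real and P Q A0 :: "real^'n^'n" and B0 K0 :: "real^'n"
  assumes "D > 0" and "tau_d > 0" and "sym_pos_def P" and "sym_pos_def Q"
  shows "\<exists>eps_star > 0. \<forall>(A :: nat \<Rightarrow> real^'n^'n) (B :: nat \<Rightarrow> real^'n) (K :: nat \<Rightarrow> real^'n) sig.
     A 0 = A0 \<and> B 0 = B0 \<and> K 0 = K0
     \<and> (\<forall>i\<le>l. controllable (A i) (B i))
     \<and> (\<forall>i\<le>l. hurwitz (A i + outer (B i) (K i)))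
     \<and> (\<forall>i\<le>l. loewner_le (transpose (A i + outer (B i) (K i)) ** P + P ** (A i + outer (B i) (K i))) (- Q))
     \<and> dwell_signal sig l tau_d
     \<and> mismatch l A B K < eps_star
     \<longrightarrow> (\<forall>X0 U0. U0 measurable_on {-D..0} \<and> (\<lambda>\<theta>. (U0 \<theta>)\<^sup>2) integrable_on {-D..0} \<longrightarrow>
          (\<exists>\<rho>>0. \<exists>\<xi>>0. \<forall>X U. closed_loop_solution l A B K D sig X0 U0 X U \<longrightarrow>
             (\<forall>t\<ge>0. norm (X t) + sqrt (integral {t - D..t} (\<lambda>\<theta>. (U \<theta>)\<^sup>2))
                 \<le> \<rho> * (norm (X 0) + sqrt (integral {-D..0} (\<lambda>\<theta>. (U \<theta>)\<^sup>2))) * exp (- \<xi> * t))))"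
proof (cases "loewner_le (transpose (A0 + outer B0 K0) ** P + P ** (A0 + outer B0 K0)) (- Q)")
  case False
  \<comment> \<open>If mode 0 violates the Lyapunov inequality, no admissible family exists and any
    positive threshold serves.\<close>
  then show ?thesis by (intro exI[of _ 1]) auto
next
  case True
  obtain c \<mu> where "c \<ge> 1" "\<mu> > 0"
    and stab0: "\<And>t x. t \<ge> 0 \<Longrightarrow> norm (mexp (t *\<^sub>R (A0 + outer B0 K0)) *v x) \<le> c * exp (- \<mu> * t) * norm x"
    using lyapunov_exponential_decay[OF assms(3,4) True] by blast
  define \<xi> where "\<xi> = \<mu> / 2"
  have "\<xi> > 0" and \<mu>: "\<mu> = 2 * \<xi>" using \<open>\<mu> > 0\<close> by (auto simp: \<xi>_def)
  \<comment> \<open>A mismatch below 1 keeps every mode within 1 of mode 0, so these bounds hold for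
    all modes.\<close>
  define a b k where "a = onorm ((*v) A0) + 1" and "b = norm B0 + 1" and "k = norm K0 + 1"
  have "onorm ((*v) A0) \<ge> 0" by (rule onorm_pos_le) simp
  then have "a \<ge> 0" "b \<ge> 0" "k \<ge> 0" by (auto simp: a_def b_def k_def)
  define G h where "G = exp (a * D)" and "h = exp (\<xi> * D)"
  define C1 where "C1 = 1 + k * exp (a * D) * (h * (1 + 2 * D))"
  define C2 where "C2 = 1 + h + b * h * C1"
  define C3 where "C3 = (1 + k) * c * C2 / \<xi> + C1"
  have "G > 0" "h > 0" by (auto simp: G_def h_def)
  have "C1 > 0" unfolding C1_def using \<open>k \<ge> 0\<close> \<open>h > 0\<close> \<open>D > 0\<close> by (intro add_pos_nonneg) auto
  then have "C2 > 0" unfolding C2_def using \<open>b \<ge> 0\<close> \<open>h > 0\<close> by (intro add_pos_nonneg) auto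
  then have "C3 > 0" unfolding C3_def using \<open>k \<ge> 0\<close> \<open>c \<ge> 1\<close> \<open>\<xi> > 0\<close> \<open>C1 > 0\<close>
    by (intro add_nonneg_pos) auto
  \<comment> \<open>The three entries secure, in order, the bounds \<open>a\<close>,
    \<open>b\<close>, \<open>k\<close> for all modes, the absorption on \<open>{0..D}\<close>, and
    the absorption in the bootstrap.\<close>
  define eps_star where "eps_star = min 1 (min (1 / (2 * G * D)) (1 / (2 * C3)))"
  have "eps_star > 0" using \<open>G > 0\<close> \<open>D > 0\<close> \<open>C3 > 0\<close> by (simp add: eps_star_def)
  \<comment> \<open>Chosen so that \<open>N \<le> C5 * S0\<close>: \<open>past_input\<close> is
    replaced by \<open>sqrt D\<close> times the initial energy norm, and 4 is the product of the
    factors 2 of the two absorptions.\<close>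
  define C5 where "C5 = 4 * (1 + k) * c * h * G * (1 + b * sqrt D) + sqrt D"
  have "C5 > 0" unfolding C5_def
    using \<open>k \<ge> 0\<close> \<open>b \<ge> 0\<close> \<open>c \<ge> 1\<close> \<open>h > 0\<close> \<open>G > 0\<close> \<open>D > 0\<close> by (intro add_nonneg_pos) auto
  define \<rho> where "\<rho> = C5 + h * (1 + sqrt D * C5)"
  have "\<rho> > 0" unfolding \<rho>_def using \<open>C5 > 0\<close> \<open>h > 0\<close> \<open>D > 0\<close> by (intro add_pos_nonneg) auto
  show ?thesis
  proof (rule exI[of _ eps_star], intro conjI \<open>eps_star > 0\<close> allI impI, elim conjE)
    fix A :: "nat \<Rightarrow> real^'n^'n" and B K :: "nat \<Rightarrow> real^'n" and sig X0 U0
    assume eq: "A 0 = A0" "B 0 = B0" "K 0 = K0"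
      and dwell: "dwell_signal sig l tau_d" and mis: "mismatch l A B K < eps_star"
    have bound: "norm (X t) + sqrt (integral {t - D..t} (\<lambda>\<theta>. (U \<theta>)\<^sup>2))
        \<le> \<rho> * (norm (X 0) + sqrt (integral {-D..0} (\<lambda>\<theta>. (U \<theta>)\<^sup>2))) * exp (- \<xi> * t)"
      if sol: "closed_loop_solution l A B K D sig X0 U0 X U" and "t \<ge> 0" for X U t
    proof -
      define \<epsilon> where "\<epsilon> = mismatch l A B K"
      note diff = mismatch_bounds[where l = l and A = A and B = B and K = K, folded \<epsilon>_def]
      have "\<epsilon> \<ge> 0" using diff(2)[of 0 0] by simp
      have "\<epsilon> \<le> 1" "\<epsilon> \<le> 1 / (2 * G * D)" "\<epsilon> \<le> 1 / (2 * C3)" using mis by (auto simp: eps_star_def \<epsilon>_def)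
      then have small: "exp (a * D) * \<epsilon> * D \<le> 1 / 2" "\<epsilon> * C3 \<le> 1 / 2"
        using \<open>G > 0\<close> \<open>D > 0\<close> \<open>C3 > 0\<close> unfolding G_def[symmetric] by (auto simp: field_simps)
      interpret bounded_delay_loop l A B K D sig X0 U0 X U a b k \<epsilon>
      proof
        show "norm (A i *v x) \<le> a * norm x" if "i \<le> l" for i x
        proof -
          have "A i *v x = A 0 *v x + (A i - A 0) *v x" by (simp add: matrix_vector_mult_diff_rdistrib)
          also have "norm \<dots> \<le> onorm ((*v) A0) * norm x + 1 * norm x"
          proof (rule norm_triangle_mono)
            show "norm (A 0 *v x) \<le> onorm ((*v) A0) * norm x" unfolding eq by (rule onorm) simp
            have "norm ((A i - A 0) *v x) \<le> \<epsilon> * norm x" using that by (intro diff) auto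
            also have "\<dots> \<le> 1 * norm x" using \<open>\<epsilon> \<le> 1\<close> by (intro mult_right_mono) auto
            finally show "norm ((A i - A 0) *v x) \<le> 1 * norm x" .
          qed
          finally show ?thesis by (simp add: a_def algebra_simps)
        qed
        show "norm (B i) \<le> b" if "i \<le> l" for i
          using norm_triangle_sub[of "B i" "B 0"] diff(2)[of i 0] that \<open>\<epsilon> \<le> 1\<close> by (simp add: eq b_def)
        show "norm (K i) \<le> k" if "i \<le> l" for i
          using norm_triangle_sub[of "K i" "K 0"] diff(3)[of i 0] that \<open>\<epsilon> \<le> 1\<close> by (simp add: eq k_def)
        show "sig t \<le> l" if "t \<ge> 0" for t using dwell that by (simp add: dwell_signal_def)
      qed (fact \<open>D > 0\<close> \<open>a \<ge> 0\<close> \<open>b \<ge> 0\<close> \<open>k \<ge> 0\<close> \<open>\<epsilon> \<ge> 0\<close> sol diff)+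
      define S where "S = sqrt (integral {-D..0} (\<lambda>s. (U s)\<^sup>2))"
      define S0 where "S0 = norm X0 + S"
      have "S \<ge> 0" unfolding S_def by (auto intro!: integral_nonneg U_square_integrable)
      then have "S \<le> S0" "S0 \<ge> 0" by (auto simp: S0_def)
      have "past_input \<le> sqrt D * S"
        unfolding past_input_def S_def
        using integral_abs_le_sqrt[of "- D" 0 U] U_abs_integrable U_square_integrable \<open>D > 0\<close> by simp
      define N where "N = 2 * ((1 + k) * c * h * (2 * exp (a * D) * (norm X0 + b * past_input))) + past_input"
      have "N \<ge> 0" unfolding N_def
        using \<open>k \<ge> 0\<close> \<open>b \<ge> 0\<close> \<open>c \<ge> 1\<close> \<open>h > 0\<close> past_input_nonneg by auto
      have stab: "norm (mexp (t *\<^sub>R (A 0 + outer (B 0) (K 0))) *v x) \<le> c * exp (- (2 * \<xi>) * t) * norm x"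
        if "t \<ge> 0" for t x
        using stab0[OF that] unfolding \<mu> eq .
      note decay = exponential_decay[OF \<open>\<xi> > 0\<close> _ \<open>c \<ge> 1\<close> stab h_def C1_def C2_def C3_def small, folded N_def]
      have "N \<le> C5 * S0"
      proof -
        have "norm X0 + b * past_input \<le> (1 + b * sqrt D) * S0"
        proof -
          have "b * past_input \<le> b * (sqrt D * S0)"
            using \<open>past_input \<le> sqrt D * S\<close> \<open>S \<le> S0\<close> \<open>b \<ge> 0\<close> \<open>D > 0\<close>
            by (intro mult_left_mono) (auto intro: order_trans mult_left_mono)
          then show ?thesis using \<open>S \<ge> 0\<close> by (simp add: S0_def algebra_simps)
        qed
        then have "4 * (1 + k) * c * h * G * (norm X0 + b * past_input) \<le> 4 * (1 + k) * c * h * G * ((1 + b * sqrt D) * S0)"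
          using \<open>k \<ge> 0\<close> \<open>c \<ge> 1\<close> \<open>h > 0\<close> \<open>G > 0\<close> by (intro mult_left_mono) auto
        moreover have "past_input \<le> sqrt D * S0"
          using \<open>past_input \<le> sqrt D * S\<close> \<open>S \<le> S0\<close> \<open>D > 0\<close> by (auto intro: order_trans mult_left_mono)
        moreover have "N = 4 * (1 + k) * c * h * G * (norm X0 + b * past_input) + past_input"
          by (simp add: N_def G_def)
        ultimately show ?thesis by (simp add: C5_def distrib_right mult.assoc)
      qed
      have "norm (X t) + sqrt (integral {t - D..t} (\<lambda>s. (U s)\<^sup>2))
          \<le> N * exp (- \<xi> * t) + h * (S + sqrt D * N) * exp (- \<xi> * t)"
        unfolding h_def S_def
        by (intro add_mono decay(1) \<open>t \<ge> 0\<close> input_energy_decay \<open>\<xi> > 0\<close> \<open>N \<ge> 0\<close> decay(2))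
      also have "\<dots> \<le> \<rho> * S0 * exp (- \<xi> * t)"
      proof -
        have "h * (S + sqrt D * N) \<le> h * (S0 + sqrt D * (C5 * S0))"
          using \<open>N \<le> C5 * S0\<close> \<open>S \<le> S0\<close> \<open>h > 0\<close> \<open>D > 0\<close> by (intro mult_left_mono add_mono) auto
        then have "N + h * (S + sqrt D * N) \<le> \<rho> * S0"
          using \<open>N \<le> C5 * S0\<close> by (simp add: \<rho>_def algebra_simps)
        then have "(N + h * (S + sqrt D * N)) * exp (- \<xi> * t) \<le> \<rho> * S0 * exp (- \<xi> * t)"
          by (intro mult_right_mono) auto
        then show ?thesis by (simp add: distrib_right)
      qed
      finally show ?thesis by (simp add: S0_def S_def X_initial)
    qed
    show "\<exists>\<rho>>0. \<exists>\<xi>>0. \<forall>X U. closed_loop_solution l A B K D sig X0 U0 X U \<longrightarrow>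
        (\<forall>t\<ge>0. norm (X t) + sqrt (integral {t - D..t} (\<lambda>\<theta>. (U \<theta>)\<^sup>2))
          \<le> \<rho> * (norm (X 0) + sqrt (integral {-D..0} (\<lambda>\<theta>. (U \<theta>)\<^sup>2))) * exp (- \<xi> * t))"
      using bound \<open>\<rho> > 0\<close> \<open>\<xi> > 0\<close> by blast
  qed
qed

end
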